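(* Let $\mathcal{F}=\{f_\omega:\mathbb{R}^d\to\mathbb{R}\}$ and $\mathcal{G}=\{g_\theta:\mathbb{R}^d\to\mathbb{R}^d\}$ be discriminator and generator classes with $\mathcal{F}$ and $\mathcal{F}\circ\mathcal{G}$ symmetric. Let $Z\sim\pi$ be the input, $X\sim\nu$ the target, $\mu_\theta$ the distribution of $g_\theta(Z)$, and let $$\widehat\theta_{m,n}\in\operatorname*{arg\,min}_{\theta:\,g_\theta\in\mathcal{G}}\ \max_{\omega:\,f_\omega\in\mathcal{F},\,\|f_\omega\|_\infty\le B}\Big\{\widehat{\mathbb{E}}_m f_\omega(g_\theta(Z))-\widehat{\mathbb{E}}_n f_\omega(X)\Big\},$$ where $B>0$ is some absolute constant. Assume that every $f\in\mathcal{F}$ is Lipschitz with constant $L_{\mathcal{F}}$ and every $g\in\mathcal{G}$ is Lipschitz with constant $L_{\mathcal{G}}$. Then, if either (1) $Z\sim N(0,I_d)$, or (2) $Z,X$ lie in $[0,1]^d$, $$\mathbb{E}\,d_W^2\big(\nu,\mu_{\widehat\theta_{m,n}}\big)\ \le\ C_1A_1(\mathcal{F},\mathcal{G},\nu)+C_2A_2(\mathcal{G},\nu)+C_3S_{n,m}(\mathcal{F},\mathcal{G}),$$ where $C_1,C_2,C_3>0$ are some constants independent of $\mathrm{Pdim}(\mathcal{F})$, $\mathrm{Pdim}(\mathcal{F}\circ\mathcal{G})$, $m$ and $n$, but depending on $L_{\mathcal{F}},L_{\mathcal{G}}$.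
   Context: The error terms are $$A_1(\mathcal{F},\mathcal{G},\nu)=\frac12\sup_\theta\inf_\omega\Big\|\log\frac{p_\nu}{p_{\mu_\theta}}-f_\omega\Big\|_\infty,\qquad A_2(\mathcal{G},\nu)=\frac{B}{4\sqrt2}\inf_\theta\Big\|\log\frac{p_{\mu_\theta}}{p_\nu}\Big\|_\infty^{1/2},$$ $$S_{n,m}(\mathcal{F},\mathcal{G})=\sqrt{\mathrm{Pdim}(\mathcal{F})\Big(\frac{\log m}{m}\vee\frac{\log n}{n}\Big)}\ \vee\ \sqrt{\mathrm{Pdim}(\mathcal{F}\circ\mathcal{G})\frac{\log m}{m}}.$$ Here $\sup_\theta,\inf_\theta$ range over $g_\theta\in\mathcal{G}$ and $\inf_\omega$ over the discriminators allowed in the estimator ($f_\omega\in\mathcal{F}$, $\|f_\omega\|_\infty\le B$); $p_\mu$ is the Lebesgue density of $\mu$; norms of log-density ratios may be $+\infty$; $a\vee b=\max(a,b)$. $\widehat{\mathbb{E}}_m$ is the empirical average over $m$ i.i.d. samples of $Z\sim\pi$ and $\widehat{\mathbb{E}}_n$ the empirical average over $n$ i.i.d. samples of $X\sim\nu$; $\mathbb{E}$ is over these samples. $d_W$ is the Wasserstein-1 distance, $d_W(\mu,\nu)=\sup\{\int f\,d\mu-\int f\,d\nu: f \text{ is 1-Lipschitz}\}$. $\mathcal{F}\circ\mathcal{G}=\{f\circ g: f\in\mathcal{F},g\in\mathcal{G}\}$. A class is symmetric if it equals its negative. The pseudo-dimension $\mathrm{Pdim}(\mathcal{F})$ of a class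 of real-valued functions on a set is the largest integer $k$ such that there exist $(x_i,y_i)$, $i=1,\dots,k$, with $x_i$ in the domain and $y_i\in\mathbb{R}$, such that for every $(b_1,\dots,b_k)\in\{-1,1\}^k$ there is $f\in\mathcal{F}$ with $\operatorname{sign}(f(x_i)-y_i)=b_i$ for all $i$.
   Formalization: Both sample sizes m and n are assumed to be at least 2; for m=1 or n=1 the terms log m/m or log n/n vanish and no bound with constants independent of m and n can hold. *)

theory Defs
  imports "HOL-Probability.Probability"
begin

text \<open>
  Function classes are sets of functions: ranging over parameters \<open>\<omega>\<close> with
  \<open>f\<^sub>\<omega> \<in> F\<close> amounts to ranging over \<open>f \<in> F\<close>, and similarly for generators.
\<close>

definition symmetric_class :: "('a \<Rightarrow> real) set \<Rightarrow> bool" where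
  "symmetric_class F \<longleftrightarrow> (\<lambda>f x. - f x) ` F = F"

definition comp_class :: "('b \<Rightarrow> 'c) set \<Rightarrow> ('a \<Rightarrow> 'b) set \<Rightarrow> ('a \<Rightarrow> 'c) set" where
  "comp_class F G = {f \<circ> g | f g. f \<in> F \<and> g \<in> G}"

definition bounded_class :: "('a \<Rightarrow> real) set \<Rightarrow> real \<Rightarrow> ('a \<Rightarrow> real) set" where
  "bounded_class F B = {f \<in> F. \<forall>x. \<bar>f x\<bar> \<le> B}"

text \<open>The value is \<open>\<infinity>\<close> if there is no largest \<open>k\<close>.\<close>

definition Pdim :: "('a \<Rightarrow> real) set \<Rightarrow> enat" where
  "Pdim F = Sup {enat k | k. \<exists>x :: nat \<Rightarrow> 'a. \<exists>y :: nat \<Rightarrow> real.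
      \<forall>b :: nat \<Rightarrow> real. (\<forall>i<k. b i \<in> {-1, 1}) \<longrightarrow>
        (\<exists>f\<in>F. \<forall>i<k. sgn (f (x i) - y i) = b i)}"

definition std_gaussian :: "(real ^ 'd) measure" where
  "std_gaussian = density lborel (\<lambda>z. ennreal (\<Prod>i\<in>UNIV. std_normal_density (z $ i)))"

definition unit_cube :: "(real ^ 'd) set" where
  "unit_cube = {x. \<forall>i. 0 \<le> x $ i \<and> x $ i \<le> 1}"

text \<open>
  The integrability side conditions are needed because the Bochner integral of a
  non-integrable function is \<open>0\<close>. They do not lower the supremum: truncations of a
  1-Lipschitz function are bounded and 1-Lipschitz, so the value is \<open>\<infinity>\<close> when it should be.
  Since the class of test functions is closed under negation, cutting off negative
  differences by \<open>ennreal\<close> is harmless.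
\<close>

definition wasserstein1 :: "'a::metric_space measure \<Rightarrow> 'a measure \<Rightarrow> ennreal" where
  "wasserstein1 \<mu> \<nu> =
     (SUP f\<in>{f :: 'a \<Rightarrow> real. 1-lipschitz_on UNIV f \<and> integrable \<mu> f \<and> integrable \<nu> f}.
        ennreal ((\<integral>x. f x \<partial>\<mu>) - (\<integral>x. f x \<partial>\<nu>)))"

definition lebesgue_density :: "'a::euclidean_space measure \<Rightarrow> 'a \<Rightarrow> real" where
  "lebesgue_density \<mu> x = enn2real (RN_deriv lborel \<mu> x)"

definition log_quotient :: "real \<Rightarrow> real \<Rightarrow> ereal" where
  "log_quotient p q = (if q = 0 then \<infinity> else if p = 0 then - \<infinity> else ereal (ln (p / q)))"

text \<open>
  The \<open>L\<^sup>\<infinity>\<close>-norm of \<open>log (p\<^sub>\<mu> / p\<^sub>\<nu>) - f\<close>. Densities are only determined almost everywhere,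
  so this is an essential supremum. Points where both densities vanish, and the quotient is
  undefined, are disregarded; where exactly one of them vanishes the logarithm is infinite.
\<close>

definition log_ratio_dist ::
    "'a::euclidean_space measure \<Rightarrow> 'a measure \<Rightarrow> ('a \<Rightarrow> real) \<Rightarrow> ennreal" where
  "log_ratio_dist \<mu> \<nu> f = esssup lborel (\<lambda>x.
     if lebesgue_density \<mu> x = 0 \<and> lebesgue_density \<nu> x = 0 then 0
     else e2ennreal \<bar>log_quotient (lebesgue_density \<mu> x) (lebesgue_density \<nu> x) - ereal (f x)\<bar>)"

definition ennreal_sqrt :: "ennreal \<Rightarrow> ennreal" where
  "ennreal_sqrt a = (if a = \<infinity> then \<infinity> else ennreal (sqrt (enn2real a)))"

text \<open>Below, \<open>\<pi>\<close> is the law of the input and \<open>\<nu>\<close> the law of the target.\<close>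

abbreviation pushforward :: "'a::topological_space measure \<Rightarrow> ('a \<Rightarrow> 'a) \<Rightarrow> 'a measure" where
  "pushforward \<pi> g \<equiv> distr \<pi> borel g"

definition A1 :: "('a::euclidean_space \<Rightarrow> real) set \<Rightarrow> ('a \<Rightarrow> 'a) set \<Rightarrow> real \<Rightarrow>
    'a measure \<Rightarrow> 'a measure \<Rightarrow> ennreal" where
  "A1 F G B \<pi> \<nu> = ennreal (1 / 2) *
     (SUP g\<in>G. INF f\<in>bounded_class F B. log_ratio_dist \<nu> (pushforward \<pi> g) f)"

definition A2 :: "('a::euclidean_space \<Rightarrow> 'a) set \<Rightarrow> real \<Rightarrow>
    'a measure \<Rightarrow> 'a measure \<Rightarrow> ennreal" where
  "A2 G B \<pi> \<nu> = ennreal (B / (4 * sqrt 2)) *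
     (INF g\<in>G. ennreal_sqrt (log_ratio_dist (pushforward \<pi> g) \<nu> (\<lambda>_. 0)))"

definition Snm :: "nat \<Rightarrow> nat \<Rightarrow> ('a \<Rightarrow> real) set \<Rightarrow> ('a \<Rightarrow> 'a) set \<Rightarrow> ennreal" where
  "Snm n m F G = max
     (ennreal_sqrt (ennreal_of_enat (Pdim F) *
        ennreal (max (ln (real m) / real m) (ln (real n) / real n))))
     (ennreal_sqrt (ennreal_of_enat (Pdim (comp_class F G)) * ennreal (ln (real m) / real m)))"

text \<open>The law of \<open>m\<close> i.i.d. inputs together with \<open>n\<close> independent i.i.d. targets.\<close>

definition sample_law :: "nat \<Rightarrow> nat \<Rightarrow> 'a measure \<Rightarrow> 'a measure \<Rightarrow>
    ((nat \<Rightarrow> 'a) \<times> (nat \<Rightarrow> 'a)) measure" where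
  "sample_law m n \<pi> \<nu> = PiM {..<m} (\<lambda>_. \<pi>) \<Otimes>\<^sub>M PiM {..<n} (\<lambda>_. \<nu>)"

definition empirical_mean :: "nat \<Rightarrow> (nat \<Rightarrow> 'a) \<Rightarrow> ('a \<Rightarrow> real) \<Rightarrow> real" where
  "empirical_mean k xs h = (\<Sum>i<k. h (xs i)) / real k"

text \<open>The supremum is not required to be attained; if it is, this is the maximum.\<close>

definition gan_objective :: "('a \<Rightarrow> real) set \<Rightarrow> real \<Rightarrow> nat \<Rightarrow> nat \<Rightarrow>
    (nat \<Rightarrow> 'a) \<times> (nat \<Rightarrow> 'a) \<Rightarrow> ('a \<Rightarrow> 'a) \<Rightarrow> ereal" where
  "gan_objective F B m n s g = (SUP f\<in>bounded_class F B.
     ereal (empirical_mean m (fst s) (\<lambda>z. f (g z)) - empirical_mean n (snd s) f))"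

end

theory Submission
  imports Defs
begin

text \<open>
  The proof compares \<open>\<nu>\<close> with the learned law \<open>\<mu>\<close> through relative entropy, and controls the
  relative entropy by the adversarial objective.

  Entropy dominates Wasserstein distance. If \<open>h\<close> is a test function for which
  \<open>h(X) - h(Y)\<close>, with \<open>X, Y\<close> independent of law \<open>\<mu>\<close>, is sub-Gaussian with variance proxy \<open>c\<close>, then
  \<open>(\<integral>h d\<nu> - \<integral>h d\<mu>)\<^sup>2 \<le> 2 c KL(\<nu> | \<mu>)\<close> (lemma \<open>transport_square\<close>, the variational formula for entropy).
  For \<open>\<mu>\<close> a Lipschitz image of a Gaussian or of a law on the cube every 1-Lipschitz \<open>h\<close> qualifies,
  with one constant depending on the dimension and the Lipschitz constant only: by convexity of
  \<open>cosh\<close> it is enough to look at the coordinates of the input (\<open>subgaussian_diff_lipschitz\<close>).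
  Bounded \<open>h\<close> qualify for every \<open>\<mu>\<close>.

  The discriminator sees the entropy. Since \<open>KL(\<mu> | \<nu>) \<ge> 0\<close>, the entropy \<open>KL(\<nu> | \<mu>)\<close> is at most the
  symmetrized entropy \<open>\<integral>log(d\<nu>/d\<mu>) d(\<nu> - \<mu>)\<close>; replacing the logarithm by a discriminator \<open>f\<close> at uniform
  distance \<open>a\<close> costs \<open>2 a\<close> (\<open>relative_entropy_le\<close>). This is where \<open>A\<^sub>1\<close> enters. What remains is
  \<open>\<integral>f d(\<nu> - \<mu>)\<close> for the learned \<open>\<mu>\<close>. By optimality of the estimator it is at most the same supremum
  for an arbitrary generator plus twice two uniform deviations of empirical means
  (\<open>gan_oracle_inequality\<close>), and for a fixed generator the transport inequality for bounded functions
  gives a multiple of \<open>A\<^sub>2\<close>.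

  Uniform deviations. Symmetrization over a ghost sample reduces the deviation over a class of
  pseudo-dimension \<open>k\<close> to a maximum of random signed sums at \<open>2n\<close> fixed points. Comparing the functions
  with \<open>n\<close> levels and applying the Sauer-Shelah bound to the resulting family of sets leaves
  polynomially many (\<open>n\<close> to a multiple of \<open>k\<close>) functions up to an error \<open>O(1/n)\<close> (\<open>Pdim_finite_net\<close>);
  the maximal inequality for sub-Gaussian sums then yields \<open>O(B sqrt(k log n / n))\<close>
  (\<open>expected_deviation_le\<close>).
\<close>

section \<open>Shattering and pseudo-dimension\<close>

definition shatters :: "'a set set \<Rightarrow> 'a set \<Rightarrow> bool" where
  "shatters U A \<longleftrightarrow> (\<forall>S\<subseteq>A. \<exists>V\<in>U. V \<inter> A = S)"

text \<open>
  Pajor's form of the Sauer-Shelah lemma. Split off one point \<open>x\<close>: the traces on the remaining points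
  that occur (\<open>P \<union> Q\<close>) and those that occur both with and without \<open>x\<close> (\<open>P \<inter> Q\<close>) together count
  the family. A set shattered by the former is shattered by the family, and a set shattered by the
  latter is still shattered after adding \<open>x\<close>.
\<close>

lemma card_le_card_shattered:
  assumes "finite X" "U \<subseteq> Pow X"
  shows "card U \<le> card {A. A \<subseteq> X \<and> shatters U A}"
  using assms
proof (induction X arbitrary: U rule: finite_induct)
  case empty
  then consider "U = {}" | "U = {{}}" by auto
  then show ?case
  proof cases
    case 2
    then have "{A. A \<subseteq> {} \<and> shatters U A} = {{}}" by (auto simp: shatters_def)
    then show ?thesis using 2 by simp
  qed simp
next
  case (insert x X)
  define P where "P = {V\<in>U. x \<notin> V}"
  define R where "R = {V\<in>U. x \<in> V}"
  define Q where "Q = (\<lambda>V. V - {x}) ` R"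
  have finU: "finite U"
    using insert.prems insert.hyps by (meson finite_Pow_iff finite_insert finite_subset)
  have fin: "finite P" "finite Q" "finite R"
    using finU by (auto simp: P_def Q_def R_def)
  have injR: "inj_on (\<lambda>V. V - {x}) R"
    by (auto simp: inj_on_def R_def)
  have sub: "P \<union> Q \<subseteq> Pow X" "P \<inter> Q \<subseteq> Pow X"
    using insert.prems by (auto simp: P_def Q_def R_def)
  have "U = P \<union> R" "P \<inter> R = {}" by (auto simp: P_def R_def)
  then have "card U = card P + card R"
    using fin by (simp add: card_Un_disjoint)
  also have "card R = card Q" unfolding Q_def using injR by (simp add: card_image)
  also have "card P + card Q = card (P \<union> Q) + card (P \<inter> Q)"
    using fin(1,2) by (rule card_Un_Int)
  also have "\<dots> \<le> card {A. A \<subseteq> X \<and> shatters (P \<union> Q) A} + card {A. A \<subseteq> X \<and> shatters (P \<inter> Q) A}"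
    using insert.IH[OF sub(1)] insert.IH[OF sub(2)] by simp
  also have "card {A. A \<subseteq> X \<and> shatters (P \<inter> Q) A}
      = card (insert x ` {A. A \<subseteq> X \<and> shatters (P \<inter> Q) A})"
    using insert.hyps by (intro card_image[symmetric]) (auto simp: inj_on_def)
  also have "card {A. A \<subseteq> X \<and> shatters (P \<union> Q) A} + \<dots>
      = card ({A. A \<subseteq> X \<and> shatters (P \<union> Q) A} \<union> insert x ` {A. A \<subseteq> X \<and> shatters (P \<inter> Q) A})"
    using insert.hyps by (intro card_Un_disjoint[symmetric]) auto
  also have "\<dots> \<le> card {A. A \<subseteq> insert x X \<and> shatters U A}"
  proof (rule card_mono)
    show "finite {A. A \<subseteq> insert x X \<and> shatters U A}" using insert.hyps by simp
    have 1: "shatters U A" if A: "A \<subseteq> X" "shatters (P \<union> Q) A" for A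
      unfolding shatters_def
    proof (intro allI impI)
      fix S assume "S \<subseteq> A"
      then obtain V where V: "V \<in> P \<union> Q" "V \<inter> A = S"
        using A(2) unfolding shatters_def by blast
      show "\<exists>V\<in>U. V \<inter> A = S"
      proof (cases "V \<in> P")
        case True
        then show ?thesis using V by (auto simp: P_def)
      next
        case False
        then obtain W where W: "W \<in> U" "V = W - {x}" using V by (auto simp: Q_def R_def)
        have "x \<notin> A" using A insert.hyps by auto
        then have "W \<inter> A = V \<inter> A" using W by auto
        then show ?thesis using V W by auto
      qed
    qed
    have 2: "shatters U (insert x A)" if A: "A \<subseteq> X" "shatters (P \<inter> Q) A" for A
      unfolding shatters_def
    proof (intro allI impI)
      fix S assume S: "S \<subseteq> insert x A"
      then have "S - {x} \<subseteq> A" by auto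
      then obtain V where V: "V \<in> P" "V \<in> Q" "V \<inter> A = S - {x}"
        using A unfolding shatters_def by blast
      obtain W where W: "W \<in> U" "x \<in> W" "V = W - {x}" using V by (auto simp: Q_def R_def)
      have "x \<notin> A" using A insert.hyps by auto
      show "\<exists>V\<in>U. V \<inter> insert x A = S"
      proof (cases "x \<in> S")
        case True
        then have "W \<inter> insert x A = insert x (V \<inter> A)" "insert x (S - {x}) = S"
          using W \<open>x \<notin> A\<close> by auto
        then show ?thesis using V W by auto
      next
        case False
        then have "V \<inter> insert x A = S" using V by (auto simp: P_def)
        then show ?thesis using V by (auto simp: P_def)
      qed
    qed
    show "{A. A \<subseteq> X \<and> shatters (P \<union> Q) A} \<union> insert x ` {A. A \<subseteq> X \<and> shatters (P \<inter> Q) A}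
        \<subseteq> {A. A \<subseteq> insert x X \<and> shatters U A}"
      using 1 2 by auto
  qed
  finally show ?case .
qed

lemma sum_binomial_le_power: "(\<Sum>i\<le>k. N choose i) \<le> (N + 1) ^ k"
proof -
  have "(\<Sum>i\<le>k. N choose i) \<le> (\<Sum>i\<le>k. (k choose i) * N ^ i)"
  proof (rule sum_mono)
    fix i assume i: "i \<in> {..k}"
    have "N choose i \<le> N ^ i"
    proof (cases "i \<le> N")
      case True then show ?thesis by (rule binomial_le_pow)
    qed (simp add: binomial_eq_0)
    also have "\<dots> \<le> (k choose i) * N ^ i"
      using i by (simp add: zero_less_binomial_iff Suc_leI)
    finally show "N choose i \<le> (k choose i) * N ^ i" .
  qed
  also have "\<dots> = (N + 1) ^ k" using binomial[of N 1 k] by simp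
  finally show ?thesis .
qed

lemma card_le_power_of_shattered_bound:
  assumes "finite X" "U \<subseteq> Pow X" "\<And>A. A \<subseteq> X \<Longrightarrow> shatters U A \<Longrightarrow> card A \<le> k"
  shows "card U \<le> (card X + 1) ^ k"
proof -
  have "card U \<le> card {A. A \<subseteq> X \<and> shatters U A}"
    using assms by (intro card_le_card_shattered)
  also have "\<dots> \<le> card (\<Union>i\<le>k. {A. A \<subseteq> X \<and> card A = i})"
    using assms by (intro card_mono finite_UN_I) auto
  also have "\<dots> \<le> (\<Sum>i\<le>k. card {A. A \<subseteq> X \<and> card A = i})"
    by (rule card_UN_le) simp
  also have "\<dots> = (\<Sum>i\<le>k. card X choose i)"
    using assms by (simp add: n_subsets)
  also have "\<dots> \<le> (card X + 1) ^ k" by (rule sum_binomial_le_power)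
  finally show ?thesis .
qed

text \<open>
  Used to perturb a threshold: \<open>f(x) > t\<close> or \<open>f(x) \<le> t\<close> has to become a strict inequality
  on both sides, as the pseudo-dimension asks for a sign \<open>1\<close> or \<open>-1\<close>.
\<close>

lemma exists_level_in_gap:
  fixes t :: real
  assumes "finite S" "\<And>s. s \<in> S \<Longrightarrow> t < s"
  shows "\<exists>y>t. \<forall>s\<in>S. y < s"
  using assms
proof (induction S rule: finite_induct)
  case empty
  then show ?case using gt_ex by auto
next
  case (insert s S)
  then obtain y where "y > t" "\<forall>s\<in>S. y < s" by auto
  moreover obtain z where "t < z" "z < min y s"
    using dense[of t "min y s"] insert.prems \<open>y > t\<close> by auto
  ultimately show ?case by (intro exI[of _ z]) auto
qed

definition pseudo_shatters :: "('a \<Rightarrow> real) set \<Rightarrow> nat \<Rightarrow> (nat \<Rightarrow> 'a) \<Rightarrow> (nat \<Rightarrow> real) \<Rightarrow> bool" where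
  "pseudo_shatters F k x y \<longleftrightarrow> (\<forall>b :: nat \<Rightarrow> real. (\<forall>i<k. b i \<in> {-1, 1}) \<longrightarrow>
     (\<exists>f\<in>F. \<forall>i<k. sgn (f (x i) - y i) = b i))"

lemma Pdim_eq: "Pdim F = Sup {enat k | k. \<exists>x y. pseudo_shatters F k x y}"
  unfolding Pdim_def pseudo_shatters_def ..

lemma pseudo_shatters_imp_le_Pdim: "pseudo_shatters F k x y \<Longrightarrow> enat k \<le> Pdim F"
  unfolding Pdim_eq by (rule Sup_upper) blast

lemma pseudo_shatters_mono: "pseudo_shatters F k x y \<Longrightarrow> F \<subseteq> F' \<Longrightarrow> pseudo_shatters F' k x y"
  unfolding pseudo_shatters_def by (meson subsetD)

lemma Pdim_mono: "F \<subseteq> F' \<Longrightarrow> Pdim F \<le> Pdim F'"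
  unfolding Pdim_eq by (rule Sup_subset_mono) (use pseudo_shatters_mono in blast)

text \<open>
  Pseudo-dimension is the VC dimension of subgraphs: shattering of indexed points \<open>(p i, t i)\<close> by
  subgraphs is pseudo-shattering after a small upward shift of the levels.
\<close>

lemma card_shattered_graph_le_Pdim:
  fixes H :: "('a \<Rightarrow> real) set" and p :: "'i \<Rightarrow> 'a" and t :: "'i \<Rightarrow> real"
  assumes "finite A" and sh: "shatters ((\<lambda>h. {i\<in>X. h (p i) > t i}) ` H) A" and "A \<subseteq> X"
  shows "enat (card A) \<le> Pdim H"
proof -
  have "\<exists>h\<in>H. {i\<in>A. h (p i) > t i} = S" if "S \<subseteq> A" for S
  proof -
    have "\<exists>V\<in>(\<lambda>h. {i\<in>X. h (p i) > t i}) ` H. V \<inter> A = S"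
      using sh that unfolding shatters_def by (elim allE[of _ S] impE)
    then obtain h where h: "h \<in> H" "{i\<in>X. h (p i) > t i} \<inter> A = S" by (elim bexE imageE) simp
    have "{i\<in>A. h (p i) > t i} = {i\<in>X. h (p i) > t i} \<inter> A" using \<open>A \<subseteq> X\<close> by auto
    then show ?thesis using h by (intro bexI[of _ h]) simp_all
  qed
  then obtain c where c: "\<And>S. S \<subseteq> A \<Longrightarrow> c S \<in> H" "\<And>S. S \<subseteq> A \<Longrightarrow> {i\<in>A. c S (p i) > t i} = S"
    by metis
  \<comment> \<open>Only the finitely many witnesses \<open>c S\<close> matter, so every level can be raised slightly
    to make all inequalities strict.\<close>
  have "\<exists>y. y > t i \<and> (\<forall>S\<subseteq>A. t i < c S (p i) \<longrightarrow> y < c S (p i))" for i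
  proof -
    have "\<exists>y>t i. \<forall>v\<in>(\<lambda>S. c S (p i)) ` {S\<in>Pow A. t i < c S (p i)}. y < v"
      using \<open>finite A\<close> by (intro exists_level_in_gap) auto
    then show ?thesis by (elim exE) (intro exI conjI, auto)
  qed
  then obtain y where y: "\<And>i. y i > t i"
    "\<And>i S. S \<subseteq> A \<Longrightarrow> t i < c S (p i) \<Longrightarrow> y i < c S (p i)"
    by metis
  obtain e where e: "bij_betw e {..<card A} A"
    using ex_bij_betw_nat_finite[OF \<open>finite A\<close>] by (auto simp: atLeast0LessThan)
  have "\<exists>f\<in>H. \<forall>i<card A. sgn (f (p (e i)) - y (e i)) = b i"
    if b: "\<forall>i<card A. b i \<in> {-1, 1}" for b :: "nat \<Rightarrow> real"
  proof
    define S where "S = e ` {i. i < card A \<and> b i = 1}"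
    have SA: "S \<subseteq> A" using e by (auto simp: S_def bij_betw_def)
    show "c S \<in> H" using c SA by auto
    show "\<forall>i<card A. sgn (c S (p (e i)) - y (e i)) = b i"
    proof (intro allI impI)
      fix i assume i: "i < card A"
      have eA: "e i \<in> A" using e i by (auto simp: bij_betw_def)
      have "e i \<in> S \<longleftrightarrow> b i = 1"
        using e i by (auto simp: S_def bij_betw_def inj_on_def)
      moreover have "e i \<in> S \<longleftrightarrow> c S (p (e i)) > t (e i)" using c(2)[OF SA] eA by blast
      moreover have "c S (p (e i)) > t (e i) \<longrightarrow> c S (p (e i)) > y (e i)" using y(2)[OF SA] by auto
      moreover have "\<not> c S (p (e i)) > t (e i) \<longrightarrow> c S (p (e i)) < y (e i)"
        using y(1)[of "e i"] by auto
      ultimately show "sgn (c S (p (e i)) - y (e i)) = b i"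
        using b i by (auto simp: sgn_real_def)
    qed
  qed
  then have "pseudo_shatters H (card A) (\<lambda>i. p (e i)) (\<lambda>i. y (e i))"
    unfolding pseudo_shatters_def by blast
  then show ?thesis by (rule pseudo_shatters_imp_le_Pdim)
qed

text \<open>
  Two values in \<open>[-B, B]\<close> further apart than the mesh are separated by one of the \<open>M\<close> levels,
  namely the first one that is at least the smaller value.
\<close>

lemma same_levels_imp_close:
  fixes B u v :: real
  assumes "M > 0" "B > 0" "\<bar>u\<bar> \<le> B" "\<bar>v\<bar> \<le> B"
    and same: "\<And>j. j < M \<Longrightarrow> u > - B + 2 * B * real j / real M \<longleftrightarrow> v > - B + 2 * B * real j / real M"
  shows "\<bar>u - v\<bar> \<le> 2 * B / real M"
proof -
  have *: "b - a \<le> 2 * B / real M"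
    if ab: "\<bar>a\<bar> \<le> B" "\<bar>b\<bar> \<le> B"
      "\<And>j. j < M \<Longrightarrow> a > - B + 2 * B * real j / real M \<longleftrightarrow> b > - B + 2 * B * real j / real M"
    for a b :: real
  proof (rule ccontr)
    assume "\<not> ?thesis"
    then have gap: "b - a > 2 * B / real M" by simp
    define d where "d = 2 * B / real M"
    have d: "d > 0" "d * real M = 2 * B" using assms by (auto simp: d_def)
    define j where "j = nat \<lceil>(a + B) / d\<rceil>"
    have "(a + B) / d \<ge> 0" using ab d by auto
    then have j: "real j \<ge> (a + B) / d" "real j < (a + B) / d + 1"
      unfolding j_def by linarith+
    have j1: "d * real j \<ge> a + B" using j d by (simp add: field_simps)
    have j2: "d * real j < a + B + d" using j d by (simp add: field_simps)
    then have "d * real j < d * real M" using gap d ab unfolding d_def[symmetric] by auto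
    then have "real j < real M" using d(1) mult_less_cancel_left_pos by blast
    then have "j < M" by simp
    then have "a > - B + d * real j \<longleftrightarrow> b > - B + d * real j" using ab(3)[of j] by (simp add: d_def)
    then show False using j1 j2 gap unfolding d_def[symmetric] by auto
  qed
  show ?thesis using *[of u v] *[of v u] assms by (auto simp: abs_le_iff)
qed

text \<open>
  The exponent is the pseudo-dimension because a function is represented by its subgraph on the
  \<open>N * M\<close> grid of points and levels, and the family of these subgraphs is bounded by the
  Sauer-Shelah lemma.
\<close>

lemma Pdim_finite_net:
  fixes H :: "('a \<Rightarrow> real) set" and p :: "nat \<Rightarrow> 'a"
  assumes "B > 0" "M > 0" and bd: "\<And>h x. h \<in> H \<Longrightarrow> \<bar>h x\<bar> \<le> B" and dim: "Pdim H = enat k"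
  shows "\<exists>H0\<subseteq>H. finite H0 \<and> card H0 \<le> (N * M + 1) ^ k \<and>
    (\<forall>h\<in>H. \<exists>h'\<in>H0. \<forall>i<N. \<bar>h (p i) - h' (p i)\<bar> \<le> 2 * B / real M)"
proof -
  define X where "X = {..<N} \<times> {..<M}"
  define t where "t = (\<lambda>(i::nat, j). - B + 2 * B * real j / real M)"
  define pat where "pat h = {a\<in>X. h (p (fst a)) > t a}" for h :: "'a \<Rightarrow> real"
  have "finite X" by (simp add: X_def)
  have "card (pat ` H) \<le> (card X + 1) ^ k"
  proof (rule card_le_power_of_shattered_bound[OF \<open>finite X\<close>])
    fix A assume A: "A \<subseteq> X" "shatters (pat ` H) A"
    have "enat (card A) \<le> Pdim H"
    proof (rule card_shattered_graph_le_Pdim)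
      show "finite A" using A finite_subset[OF _ \<open>finite X\<close>] by blast
      show "shatters ((\<lambda>h. {i \<in> X. t i < h (p (fst i))}) ` H) A"
        using A by (simp add: pat_def[abs_def])
    qed (use A in auto)
    then show "card A \<le> k" by (simp add: dim)
  qed (auto simp: pat_def)
  then have card: "card (pat ` H) \<le> (N * M + 1) ^ k" by (simp add: X_def)
  have fin: "finite (pat ` H)"
    by (rule finite_subset[of _ "Pow X"]) (auto simp: pat_def \<open>finite X\<close>)
  have "\<exists>c. \<forall>V\<in>pat ` H. c V \<in> H \<and> pat (c V) = V" by (intro bchoice) auto
  then obtain c where c: "\<And>V. V \<in> pat ` H \<Longrightarrow> c V \<in> H \<and> pat (c V) = V" by auto
  show ?thesis
  proof (intro exI[of _ "c ` pat ` H"] conjI ballI)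
    show "c ` pat ` H \<subseteq> H" using c by auto
    show "finite (c ` pat ` H)" using fin by simp
    show "card (c ` pat ` H) \<le> (N * M + 1) ^ k" using card card_image_le[OF fin, of c] by simp
    fix h assume h: "h \<in> H"
    let ?h' = "c (pat h)"
    have h': "?h' \<in> H" "pat ?h' = pat h" using c[of "pat h"] h by auto
    have "\<bar>h (p i) - ?h' (p i)\<bar> \<le> 2 * B / real M" if "i < N" for i
    proof (rule same_levels_imp_close)
      fix j assume j: "j < M"
      have "(i, j) \<in> pat h \<longleftrightarrow> (i, j) \<in> pat ?h'" using h' by simp
      then show "h (p i) > - B + 2 * B * real j / real M \<longleftrightarrow> ?h' (p i) > - B + 2 * B * real j / real M"
        using j that by (simp add: pat_def X_def t_def)
    qed (use assms h h' in auto)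
    then show "\<exists>h'\<in>c ` pat ` H. \<forall>i<N. \<bar>h (p i) - h' (p i)\<bar> \<le> 2 * B / real M"
      using h by (intro bexI[of _ ?h']) auto
  qed
qed

text \<open>
  Two distinct functions differ at some point and a level between their values there is
  pseudo-shattered. Hence a symmetric class of pseudo-dimension \<open>0\<close> contains at most the zero
  function, so that no deviation has to be paid for when the rate is \<open>0\<close>.
\<close>

lemma Pdim_zero_unique:
  assumes "Pdim H = 0" "h \<in> H" "h' \<in> H"
  shows "h = h'"
proof (rule ccontr)
  assume "h \<noteq> h'"
  then obtain x where "h x \<noteq> h' x" by auto
  then obtain g g' where g: "g \<in> H" "g' \<in> H" "g x < g' x"
    using assms by (metis linorder_neqE_linordered_idom)
  then obtain y where y: "g x < y" "y < g' x" using dense by blast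
  have "pseudo_shatters H 1 (\<lambda>_. x) (\<lambda>_. y)"
    unfolding pseudo_shatters_def
  proof (intro allI impI)
    fix b :: "nat \<Rightarrow> real" assume "\<forall>i<1. b i \<in> {-1, 1}"
    then consider "b 0 = 1" | "b 0 = -1" by auto
    then show "\<exists>f\<in>H. \<forall>i<1. sgn (f x - y) = b i"
    proof cases
      case 1 then show ?thesis using g y by (intro bexI[of _ g']) auto
    next
      case 2 then show ?thesis using g y by (intro bexI[of _ g]) auto
    qed
  qed
  then have "enat 1 \<le> Pdim H" by (rule pseudo_shatters_imp_le_Pdim)
  then show False using assms by (simp add: enat_0_iff one_enat_def)
qed

section \<open>Maxima of Rademacher sums\<close>

lemma two_power_mult_fact_le: "2 ^ n * fact n \<le> (fact (2 * n) :: real)"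
proof (induction n)
  case (Suc n)
  have "2 ^ Suc n * fact (Suc n) = (2 * real n + 2) * (2 ^ n * fact n :: real)"
    by (simp add: algebra_simps)
  also have "\<dots> \<le> (2 * real n + 2) * fact (2 * n)"
    using Suc by (intro mult_left_mono) auto
  also have "\<dots> \<le> (2 * real n + 2) * ((2 * real n + 1) * fact (2 * n))"
    by (intro mult_left_mono) (simp_all add: algebra_simps)
  also have "\<dots> = fact (2 * Suc n)"
    by (simp add: algebra_simps)
  finally show ?case .
qed simp

text \<open>
  Termwise comparison of the power series, as \<open>(2n)! \<ge> 2\<^sup>n n!\<close>.
\<close>

lemma cosh_le_exp_half_square: "cosh (x :: real) \<le> exp (x\<^sup>2 / 2)"
proof -
  define f where "f n = (if even n then x ^ n /\<^sub>R fact n else 0)" for n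
  have "f sums cosh x" unfolding f_def by (rule cosh_converges)
  moreover have "strict_mono (\<lambda>n::nat. 2 * n)" by (simp add: strict_mono_def)
  moreover have "f n = 0" if "n \<notin> range (\<lambda>n::nat. 2 * n)" for n
    using that by (auto simp: f_def elim!: evenE)
  ultimately have *: "(\<lambda>n. f (2 * n)) sums cosh x"
    by (subst sums_mono_reindex[of "\<lambda>n. 2 * n" f]) auto
  have "(\<lambda>n. (x\<^sup>2 / 2) ^ n /\<^sub>R fact n) sums exp (x\<^sup>2 / 2)" by (rule exp_converges)
  with * show ?thesis
  proof (rule sums_le[rotated 1])
    fix n
    have "f (2 * n) = (x\<^sup>2) ^ n / fact (2 * n)"
      by (simp add: f_def power_mult[symmetric] divide_inverse mult.commute)
    also have "\<dots> \<le> (x\<^sup>2) ^ n / (2 ^ n * fact n)"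
      using two_power_mult_fact_le[of n] by (intro divide_left_mono) auto
    also have "\<dots> = (x\<^sup>2 / 2) ^ n /\<^sub>R fact n"
      by (simp add: power_divide field_simps)
    finally show "f (2 * n) \<le> (x\<^sup>2 / 2) ^ n /\<^sub>R fact n" .
  qed
qed

definition sign_of :: "nat set \<Rightarrow> nat \<Rightarrow> real" where
  "sign_of S i = (if i \<in> S then -1 else 1)"

text \<open>
  The moment generating function of a Rademacher sum, the expectation being a finite sum over the
  sets \<open>S\<close> of negative signs; it factorizes over the coordinates.
\<close>

lemma sum_exp_signs_le:
  "(\<Sum>S\<in>Pow {..<n}. exp (l * (\<Sum>i<n. sign_of S i * v i))) \<le> 2 ^ n * exp (l\<^sup>2 * (\<Sum>i<n. (v i)\<^sup>2) / 2)"
proof -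
  have "(\<Sum>S\<in>Pow {..<n}. exp (l * (\<Sum>i<n. sign_of S i * v i)))
     = (\<Sum>S\<in>Pow {..<n}. (\<Prod>i\<in>S. exp (- (l * v i))) * (\<Prod>i\<in>{..<n}-S. exp (l * v i)))"
  proof (rule sum.cong[OF refl])
    fix S assume S: "S \<in> Pow {..<n}"
    have "(\<Sum>i<n. sign_of S i * v i) = (\<Sum>i\<in>{..<n}-S. sign_of S i * v i) + (\<Sum>i\<in>S. sign_of S i * v i)"
      using S by (intro sum.subset_diff) auto
    also have "\<dots> = (\<Sum>i\<in>{..<n}-S. v i) + (\<Sum>i\<in>S. - v i)"
      by (intro arg_cong2[where f="(+)"] sum.cong) (auto simp: sign_of_def)
    finally have "l * (\<Sum>i<n. sign_of S i * v i) = (\<Sum>i\<in>{..<n}-S. l * v i) + (\<Sum>i\<in>S. - (l * v i))"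
      by (simp add: right_diff_distrib sum_distrib_left sum_negf)
    then show "exp (l * (\<Sum>i<n. sign_of S i * v i))
       = (\<Prod>i\<in>S. exp (- (l * v i))) * (\<Prod>i\<in>{..<n}-S. exp (l * v i))"
      using S finite_subset[of S "{..<n}"] by (simp add: exp_add exp_sum)
  qed
  also have "\<dots> = (\<Prod>i<n. exp (- (l * v i)) + exp (l * v i))"
    by (rule prod_add[symmetric]) simp
  also have "\<dots> = (\<Prod>i<n. 2 * cosh (l * v i))"
    by (intro prod.cong refl) (simp add: cosh_field_def field_simps)
  also have "\<dots> \<le> (\<Prod>i<n. 2 * exp ((l * v i)\<^sup>2 / 2))"
    using cosh_le_exp_half_square by (intro prod_mono) auto
  also have "\<dots> = 2 ^ n * exp (\<Sum>i<n. (l * v i)\<^sup>2 / 2)"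
    by (simp add: prod.distrib exp_sum)
  also have "(\<Sum>i<n. (l * v i)\<^sup>2 / 2) = l\<^sup>2 * (\<Sum>i<n. (v i)\<^sup>2) / 2"
    by (simp add: sum_divide_distrib sum_distrib_left power_mult_distrib)
  finally show ?thesis .
qed

lemma le_ln_add_exp_div:
  fixes c y :: real
  assumes "c > 0"
  shows "y \<le> ln c + exp y / c - 1"
  using exp_ge_add_one_self[of "y - ln c"] assms by (simp add: exp_diff)

text \<open>
  Massart's maximal inequality. The functional \<open>u\<close> is dominated by the maximum of \<open>0\<close> and of finitely
  many signed sums, so \<open>exp(l u)\<close> is at most one plus the sum of their exponentials. The
  tangent bound \<open>y \<le> ln c + exp y / c - 1\<close> plays the role of Jensen's inequality for the logarithm,
  with \<open>c\<close> chosen as the bound for the mean of that sum.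
\<close>

lemma massart_signs:
  fixes u :: "nat set \<Rightarrow> real" and v :: "'h \<Rightarrow> nat \<Rightarrow> real"
  assumes "finite H" "n > 0" "b > 0"
    and v: "\<And>h i. h \<in> H \<Longrightarrow> i < n \<Longrightarrow> \<bar>v h i\<bar> \<le> b"
    and u: "\<And>S. S \<subseteq> {..<n} \<Longrightarrow> u S \<le> 0 \<or> (\<exists>h\<in>H. u S \<le> (\<Sum>i<n. sign_of S i * v h i))"
    and L: "L > 0" "ln (real (card H + 1)) \<le> L"
  shows "(\<Sum>S\<in>Pow {..<n}. u S) \<le> 2 ^ n * (b * sqrt (2 * L * real n))"
proof -
  \<comment> \<open>This choice of \<open>l\<close> balances \<open>L / l\<close> against \<open>l * n * b\<^sup>2 / 2\<close>.\<close>
  define l where "l = sqrt (2 * L / real n) / b"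
  have l: "l > 0" using assms by (simp add: l_def)
  define E where "E = exp (l\<^sup>2 * (real n * b\<^sup>2) / 2)"
  have E: "E \<ge> 1" by (simp add: E_def)
  define c where "c = real (card H + 1) * E"
  have c: "c > 0" using E by (simp add: c_def)
  have vE: "exp (l\<^sup>2 * (\<Sum>i<n. (v h i)\<^sup>2) / 2) \<le> E" if "h \<in> H" for h
  proof -
    have "(\<Sum>i<n. (v h i)\<^sup>2) \<le> (\<Sum>i<n. b\<^sup>2)"
      using v[OF that] by (intro sum_mono power2_le_iff_abs_le[THEN iffD2]) (use \<open>b > 0\<close> in auto)
    then show ?thesis unfolding E_def
      using l by (auto intro!: divide_right_mono mult_left_mono)
  qed
  have pointwise: "l * u S \<le> (ln c - 1) + (1 + (\<Sum>h\<in>H. exp (l * (\<Sum>i<n. sign_of S i * v h i)))) / c"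
    if "S \<subseteq> {..<n}" for S
  proof -
    have nn: "0 \<le> (\<Sum>h\<in>H. exp (l * (\<Sum>i<n. sign_of S i * v h i)))" by (intro sum_nonneg) simp
    have "exp (l * u S) \<le> 1 + (\<Sum>h\<in>H. exp (l * (\<Sum>i<n. sign_of S i * v h i)))"
      using u[OF that]
    proof
      assume "u S \<le> 0"
      then have "l * u S \<le> 0" using l by (simp add: mult_nonneg_nonpos)
      then have "exp (l * u S) \<le> 1" by (simp only: exp_le_one_iff)
      then show ?thesis using nn by linarith
    next
      assume "\<exists>h\<in>H. u S \<le> (\<Sum>i<n. sign_of S i * v h i)"
      then obtain h where h: "h \<in> H" "u S \<le> (\<Sum>i<n. sign_of S i * v h i)" by blast
      have "exp (l * u S) \<le> exp (l * (\<Sum>i<n. sign_of S i * v h i))"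
        using h l by simp
      also have "\<dots> \<le> (\<Sum>h\<in>H. exp (l * (\<Sum>i<n. sign_of S i * v h i)))"
        using h \<open>finite H\<close> by (intro member_le_sum) auto
      finally show ?thesis by simp
    qed
    then have "exp (l * u S) / c \<le> (1 + (\<Sum>h\<in>H. exp (l * (\<Sum>i<n. sign_of S i * v h i)))) / c"
      using c by (intro divide_right_mono) auto
    then show ?thesis using le_ln_add_exp_div[OF c, of "l * u S"] by linarith
  qed
  have "l * (\<Sum>S\<in>Pow {..<n}. u S) = (\<Sum>S\<in>Pow {..<n}. l * u S)" by (rule sum_distrib_left)
  also have "\<dots> \<le> (\<Sum>S\<in>Pow {..<n}. (ln c - 1) + (1 + (\<Sum>h\<in>H. exp (l * (\<Sum>i<n. sign_of S i * v h i)))) / c)"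
    by (intro sum_mono pointwise) auto
  also have "\<dots> = 2 ^ n * (ln c - 1) + (2 ^ n + (\<Sum>h\<in>H. \<Sum>S\<in>Pow {..<n}. exp (l * (\<Sum>i<n. sign_of S i * v h i)))) / c"
    by (subst sum.swap) (simp add: sum.distrib sum_divide_distrib[symmetric] card_Pow)
  also have "\<dots> \<le> 2 ^ n * (ln c - 1) + (2 ^ n * E + (\<Sum>h\<in>H. 2 ^ n * E)) / c"
    using c E by (intro add_left_mono divide_right_mono add_mono sum_mono
        order_trans[OF sum_exp_signs_le] mult_left_mono vE) auto
  also have "2 ^ n * E + (\<Sum>h\<in>H. 2 ^ n * E) = 2 ^ n * c"
    by (simp add: c_def algebra_simps)
  also have "2 ^ n * (ln c - 1) + 2 ^ n * c / c = 2 ^ n * ln c" using c by (simp add: algebra_simps)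
  also have "ln c = ln (real (card H + 1)) + l\<^sup>2 * (real n * b\<^sup>2) / 2"
    unfolding c_def E_def by (subst ln_mult) auto
  also have "2 ^ n * (ln (real (card H + 1)) + l\<^sup>2 * (real n * b\<^sup>2) / 2) \<le> 2 ^ n * (2 * L)"
  proof -
    have "l\<^sup>2 * (real n * b\<^sup>2) / 2 = L"
      using assms by (simp add: l_def power_divide)
    then show ?thesis using L by (intro mult_left_mono) auto
  qed
  also have "2 * L = l * (b * sqrt (2 * L * real n))"
  proof -
    have "l * (b * sqrt (2 * L * real n)) = sqrt (2 * L / real n) * sqrt (2 * L * real n)"
      using \<open>b > 0\<close> by (simp add: l_def)
    also have "\<dots> = sqrt ((2 * L / real n) * (2 * L * real n))" by (simp only: real_sqrt_mult)
    also have "(2 * L / real n) * (2 * L * real n) = (2 * L)\<^sup>2"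
      using \<open>n > 0\<close> by (simp add: power2_eq_square)
    also have "sqrt ((2 * L)\<^sup>2) = 2 * L" using L(1) by (subst real_sqrt_abs) simp
    finally show ?thesis by simp
  qed
  finally have "l * (\<Sum>S\<in>Pow {..<n}. u S) \<le> l * (2 ^ n * (b * sqrt (2 * L * real n)))"
    by (simp add: mult_ac)
  then show ?thesis using l by simp
qed

text \<open>
  The net at \<open>2n\<close> points and \<open>n\<close> levels, enlarged by the zero function, has logarithmic size at most
  \<open>5 k ln n\<close>.
\<close>

lemma net_size_le_power:
  fixes n k :: nat
  assumes "n \<ge> 2" "k \<ge> 1"
  shows "(2 * n * n + 1) ^ k + 1 \<le> n ^ (5 * k)"
proof -
  have "(2 * n * n + 1) ^ k + 1 \<le> 2 * (2 * n * n + 1) ^ k" by simp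
  also have "\<dots> \<le> 2 ^ k * (2 * n * n + 1) ^ k"
    using assms by (intro mult_right_mono) (simp_all add: self_le_power)
  also have "\<dots> = (4 * (n * n) + 2) ^ k" by (simp add: power_mult_distrib[symmetric] algebra_simps)
  also have "\<dots> \<le> (n ^ 5) ^ k"
  proof (rule power_mono)
    have "2 * 2 \<le> n * n" using assms by (intro mult_mono) auto
    then have nn: "4 \<le> n * n" by simp
    have "4 * (n * n) + 2 \<le> 8 * (n * n)" using nn by linarith
    also have "\<dots> \<le> n ^ 3 * (n * n)"
      using power_mono[OF assms(1), of 3] by (intro mult_right_mono) auto
    also have "\<dots> = n ^ 5" by (simp add: numeral_eq_Suc)
    finally show "4 * (n * n) + 2 \<le> n ^ 5" .
  qed simp
  finally show ?thesis by (simp add: power_mult)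
qed

section \<open>Uniform deviations of empirical means\<close>

text \<open>
  A product over a set of natural numbers is viewed inside the full sequence space, where
  points of the product are \<open>undefined\<close> off the index set. This makes the topology of the
  sequence space available for measurability questions.
\<close>

lemma measurable_PiM_id:
  fixes M :: "'a::second_countable_topology measure" and I :: "nat set"
  assumes "sets M = sets borel"
  shows "(\<lambda>w. w) \<in> borel_measurable (PiM I (\<lambda>_. M))"
proof (rule measurable_coordinatewise_then_product)
  fix i
  show "(\<lambda>w. w i) \<in> borel_measurable (PiM I (\<lambda>_. M))"
  proof (cases "i \<in> I")
    case True
    then have "(\<lambda>w. w i) \<in> measurable (PiM I (\<lambda>_. M)) M" by (rule measurable_component_singleton)
    then show ?thesis using measurable_cong_sets[OF refl assms] by blast
  next
    case False
    have "(\<lambda>w. w i) \<in> borel_measurable (PiM I (\<lambda>_. M)) \<longleftrightarrow> (\<lambda>w. undefined :: 'a) \<in> borel_measurable (PiM I (\<lambda>_. M))"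
      using False by (intro measurable_cong) (auto simp: space_PiM PiE_def extensional_def)
    then show ?thesis by simp
  qed
qed

text \<open>
  A supremum of continuous functions is lower semicontinuous, so suprema over uncountable
  function classes are measurable.
\<close>

lemma borel_measurable_SUP_continuous:
  fixes \<phi> :: "'h \<Rightarrow> 'a::topological_space \<Rightarrow> real"
  assumes "\<And>h. h \<in> H \<Longrightarrow> continuous_on UNIV (\<phi> h)"
  shows "(\<lambda>x. SUP h\<in>H. ennreal (\<phi> h x)) \<in> borel_measurable borel"
proof (rule borel_measurableI_greater)
  fix y :: ennreal
  have "{x. y < (SUP h\<in>H. ennreal (\<phi> h x))} = (\<Union>h\<in>H. {x. y < ennreal (\<phi> h x)})"
    by (auto simp: less_SUP_iff)
  also have "open \<dots>"
    using assms by (intro open_UN ballI open_Collect_less continuous_on_const continuous_on_ennreal) auto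
  finally show "{x\<in>space borel. y < (SUP h\<in>H. ennreal (\<phi> h x))} \<in> sets borel" by simp
qed

lemma borel_measurable_SUP_PiM:
  fixes \<phi> :: "'h \<Rightarrow> (nat \<Rightarrow> 'a::second_countable_topology) \<Rightarrow> real"
  assumes "sets M = sets borel" "\<And>h. h \<in> H \<Longrightarrow> continuous_on UNIV (\<phi> h)"
  shows "(\<lambda>w. SUP h\<in>H. ennreal (\<phi> h w)) \<in> borel_measurable (PiM I (\<lambda>_. M))"
  using measurable_compose[OF measurable_PiM_id borel_measurable_SUP_continuous] assms by blast

lemma continuous_on_coordinate_sample:
  fixes h :: "'a::topological_space \<Rightarrow> real"
  assumes "continuous_on UNIV h"
  shows "continuous_on UNIV (\<lambda>w :: nat \<Rightarrow> 'a. h (w i))"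
  using continuous_on_compose2[OF assms continuous_on_product_coordinates[of i]] by simp

lemma ennreal_integral_le_nn_integral:
  fixes f :: "'a \<Rightarrow> real"
  assumes "integrable M f"
  shows "ennreal (\<integral>x. f x \<partial>M) \<le> (\<integral>\<^sup>+x. ennreal (f x) \<partial>M)"
proof -
  have "ennreal (\<integral>x. f x \<partial>M) \<le> ennreal (\<integral>x. max 0 (f x) \<partial>M)"
    using assms by (intro ennreal_leI integral_mono) auto
  also have "\<dots> = (\<integral>\<^sup>+x. ennreal (max 0 (f x)) \<partial>M)"
    using assms by (intro nn_integral_eq_integral[symmetric]) auto
  also have "\<dots> = (\<integral>\<^sup>+x. ennreal (f x) \<partial>M)"
    by (intro nn_integral_cong) (auto simp: max_def ennreal_neg)
  finally show ?thesis .
qed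

lemma nn_integral_PiM_reindex:
  fixes M :: "'a measure"
  assumes "prob_space M" "inj_on s I" "s \<in> I \<rightarrow> K"
    and [measurable]: "f \<in> borel_measurable (PiM I (\<lambda>_. M))"
  shows "(\<integral>\<^sup>+ w. f w \<partial>PiM I (\<lambda>_. M)) = (\<integral>\<^sup>+ w. f (\<lambda>i\<in>I. w (s i)) \<partial>PiM K (\<lambda>_. M))"
proof -
  have [measurable]: "(\<lambda>w. \<lambda>i\<in>I. w (s i)) \<in> measurable (PiM K (\<lambda>_. M)) (PiM I (\<lambda>_. M))"
    using assms(3) by (intro measurable_restrict measurable_component_singleton) auto
  have "distr (PiM K (\<lambda>_. M)) (PiM I (\<lambda>_. M)) (\<lambda>w. \<lambda>i\<in>I. w (s i)) = PiM I (\<lambda>_. M)"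
    using distr_PiM_reindex[of K "\<lambda>_. M" s I] assms by simp
  then have "(\<integral>\<^sup>+ w. f w \<partial>PiM I (\<lambda>_. M))
      = (\<integral>\<^sup>+ w. f w \<partial>distr (PiM K (\<lambda>_. M)) (PiM I (\<lambda>_. M)) (\<lambda>w. \<lambda>i\<in>I. w (s i)))" by simp
  also have "\<dots> = (\<integral>\<^sup>+ w. f (\<lambda>i\<in>I. w (s i)) \<partial>PiM K (\<lambda>_. M))"
    by (subst nn_integral_distr) auto
  finally show ?thesis .
qed

lemma integral_PiM_component:
  fixes h :: "'a \<Rightarrow> real"
  assumes "prob_space M" "i \<in> I" "h \<in> borel_measurable M"
  shows "(\<integral>w. h (w i) \<partial>PiM I (\<lambda>_. M)) = (\<integral>x. h x \<partial>M)"
proof -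
  have d: "distr (PiM I (\<lambda>_. M)) M (\<lambda>w. w i) = M"
    using distr_PiM_component[of I "\<lambda>_. M" i] assms by simp
  have "(\<integral>x. h x \<partial>M) = (\<integral>x. h x \<partial>distr (PiM I (\<lambda>_. M)) M (\<lambda>w. w i))" by (simp only: d)
  also have "\<dots> = (\<integral>w. h (w i) \<partial>PiM I (\<lambda>_. M))"
    using assms by (intro integral_distr measurable_component_singleton) auto
  finally show ?thesis by simp
qed

text \<open>
  Coordinates \<open>i\<close> and \<open>n + i\<close> of the double sample are a sample point and its ghost.
\<close>

definition signed_sup :: "('a \<Rightarrow> real) set \<Rightarrow> nat \<Rightarrow> nat set \<Rightarrow> (nat \<Rightarrow> 'a) \<Rightarrow> ennreal" where
  "signed_sup H n S w = (SUP h\<in>H. ennreal ((\<Sum>i<n. sign_of S i * (h (w (n + i)) - h (w i))) / real n))"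

text \<open>
  Only the positive part of the one-sided deviation is recorded; for classes closed under
  negation this loses nothing.
\<close>

definition deviation :: "('a \<Rightarrow> real) set \<Rightarrow> nat \<Rightarrow> 'a measure \<Rightarrow> (nat \<Rightarrow> 'a) \<Rightarrow> ennreal" where
  "deviation H n M w = (SUP h\<in>H. ennreal ((\<integral>x. h x \<partial>M) - empirical_mean n w h))"

context
  fixes M :: "'a::second_countable_topology measure" and H :: "('a \<Rightarrow> real) set" and B :: real and n :: nat
  assumes M: "prob_space M" "sets M = sets borel"
    and cont: "\<And>h. h \<in> H \<Longrightarrow> continuous_on UNIV h"
    and bd: "\<And>h x. h \<in> H \<Longrightarrow> \<bar>h x\<bar> \<le> B"
begin

lemma borel_measurable_class_member: "h \<in> H \<Longrightarrow> h \<in> borel_measurable M"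
  using borel_measurable_continuous_onI[OF cont] measurable_cong_sets[OF M(2) refl] by blast

lemma measurable_signed_sup: "signed_sup H n S \<in> borel_measurable (PiM I (\<lambda>_. M))"
  unfolding signed_sup_def[abs_def]
proof (rule borel_measurable_SUP_PiM[OF M(2)])
  fix h assume "h \<in> H"
  note [continuous_intros] = continuous_on_coordinate_sample[OF cont[OF this]]
  show "continuous_on UNIV (\<lambda>w. (\<Sum>i<n. sign_of S i * (h (w (n + i)) - h (w i))) / real n)"
    unfolding divide_inverse by (intro continuous_intros)
qed

lemma measurable_deviation: "deviation H n M \<in> borel_measurable (PiM I (\<lambda>_. M))"
  unfolding deviation_def[abs_def] empirical_mean_def
proof (rule borel_measurable_SUP_PiM[OF M(2)])
  fix h assume "h \<in> H"
  note [continuous_intros] = continuous_on_coordinate_sample[OF cont[OF this]]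
  show "continuous_on UNIV (\<lambda>w. (\<integral>x. h x \<partial>M) - (\<Sum>i<n. h (w i)) / real n)"
    unfolding divide_inverse by (intro continuous_intros)
qed

lemma deviation_le_ghost_sample:
  assumes "n > 0"
  shows "deviation H n M w \<le> (\<integral>\<^sup>+ y. signed_sup H n {} (merge {..<n} {n..<2*n} (w, y)) \<partial>PiM {n..<2*n} (\<lambda>_. M))"
  unfolding deviation_def
proof (rule SUP_least)
  fix h assume h: "h \<in> H"
  let ?J = "PiM {n..<2*n} (\<lambda>_. M)"
  interpret J: prob_space ?J using M(1) by (intro prob_space_PiM)
  have meas: "(\<lambda>y. h (y (n + i))) \<in> borel_measurable ?J" if "i < n" for i
    using that measurable_compose[OF measurable_component_singleton[of "n + i" "{n..<2*n}" "\<lambda>_. M"] borel_measurable_class_member[OF h]]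
    by simp
  have int: "integrable ?J (\<lambda>y. h (y (n + i)))" if "i < n" for i
    using meas[OF that] bd[OF h] by (intro J.integrable_const_bound[of _ B]) auto
  have "(\<integral>x. h x \<partial>M) - empirical_mean n w h
      = (\<integral>y. (\<Sum>i<n. h (y (n + i)) - h (w i)) / real n \<partial>?J)"
  proof -
    have "(\<integral>y. (\<Sum>i<n. h (y (n + i)) - h (w i)) / real n \<partial>?J) = (\<Sum>i<n. (\<integral>y. h (y (n + i)) \<partial>?J) - h (w i)) / real n"
      using int by (simp add: Bochner_Integration.integral_diff J.prob_space)
    also have "\<dots> = (\<Sum>i<n. (\<integral>x. h x \<partial>M) - h (w i)) / real n"
      using integral_PiM_component[OF M(1) _ borel_measurable_class_member[OF h], of _ "{n..<2*n}"]
      by (intro arg_cong2[where f="(/)"] sum.cong refl) auto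
    also have "\<dots> = (\<integral>x. h x \<partial>M) - empirical_mean n w h"
      using assms by (simp add: empirical_mean_def sum_subtractf field_simps)
    finally show ?thesis by simp
  qed
  then have "ennreal ((\<integral>x. h x \<partial>M) - empirical_mean n w h)
      \<le> (\<integral>\<^sup>+y. ennreal ((\<Sum>i<n. h (y (n + i)) - h (w i)) / real n) \<partial>?J)"
    using int by (simp only:) (intro ennreal_integral_le_nn_integral integrable_divide
      Bochner_Integration.integrable_sum Bochner_Integration.integrable_diff J.integrable_const, auto)
  also have "\<dots> \<le> (\<integral>\<^sup>+ y. signed_sup H n {} (merge {..<n} {n..<2*n} (w, y)) \<partial>?J)"
  proof (rule nn_integral_mono)
    fix y
    have "(\<Sum>i<n. h (y (n + i)) - h (w i)) =
       (\<Sum>i<n. sign_of {} i * (h (merge {..<n} {n..<2*n} (w, y) (n + i)) - h (merge {..<n} {n..<2*n} (w, y) i)))"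
      by (intro sum.cong refl) (simp add: sign_of_def merge_def)
    then show "ennreal ((\<Sum>i<n. h (y (n + i)) - h (w i)) / real n)
        \<le> signed_sup H n {} (merge {..<n} {n..<2*n} (w, y))"
      unfolding signed_sup_def using h by (intro SUP_upper2[of h]) auto
  qed
  finally show "ennreal ((\<integral>x. h x \<partial>M) - empirical_mean n w h)
     \<le> (\<integral>\<^sup>+ y. signed_sup H n {} (merge {..<n} {n..<2*n} (w, y)) \<partial>?J)" .
qed

text \<open>
  The true mean is the mean over a ghost sample, and the supremum of an integral is at most the
  integral of the supremum.
\<close>

lemma symmetrization:
  assumes "n > 0"
  shows "(\<integral>\<^sup>+ w. deviation H n M w \<partial>PiM {..<n} (\<lambda>_. M)) \<le> (\<integral>\<^sup>+ w. signed_sup H n {} w \<partial>PiM {..<2*n} (\<lambda>_. M))"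
proof -
  interpret product_sigma_finite "\<lambda>_::nat. M"
    by (simp add: product_sigma_finite_def M(1) prob_space_imp_sigma_finite)
  have "(\<integral>\<^sup>+ w. deviation H n M w \<partial>PiM {..<n} (\<lambda>_. M))
     \<le> (\<integral>\<^sup>+ w. \<integral>\<^sup>+ y. signed_sup H n {} (merge {..<n} {n..<2*n} (w, y)) \<partial>PiM {n..<2*n} (\<lambda>_. M) \<partial>PiM {..<n} (\<lambda>_. M))"
    by (intro nn_integral_mono deviation_le_ghost_sample assms)
  also have "\<dots> = (\<integral>\<^sup>+ w. signed_sup H n {} w \<partial>PiM ({..<n} \<union> {n..<2*n}) (\<lambda>_. M))"
    by (intro product_nn_integral_fold[symmetric] measurable_signed_sup) auto
  also have "{..<n} \<union> {n..<2*n} = {..<2*n}" by auto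
  finally show ?thesis .
qed

text \<open>
  Exchanging a sample point with its ghost preserves the law of the double sample and flips the
  corresponding sign.
\<close>

lemma nn_integral_signed_sup_swap:
  assumes "S \<subseteq> {..<n}"
  shows "(\<integral>\<^sup>+ w. signed_sup H n {} w \<partial>PiM {..<2*n} (\<lambda>_. M)) = (\<integral>\<^sup>+ w. signed_sup H n S w \<partial>PiM {..<2*n} (\<lambda>_. M))"
proof -
  \<comment> \<open>The involution that exchanges \<open>i\<close> and \<open>n + i\<close> for \<open>i \<in> S\<close>.\<close>
  define s where "s j = (if j \<in> S then n + j else if j \<ge> n \<and> j - n \<in> S then j - n else j)" for j
  have s_s: "s (s j) = j" for j using assms by (auto simp: s_def)
  have "(\<integral>\<^sup>+ w. signed_sup H n {} w \<partial>PiM {..<2*n} (\<lambda>_. M))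
      = (\<integral>\<^sup>+ w. signed_sup H n {} (\<lambda>i\<in>{..<2*n}. w (s i)) \<partial>PiM {..<2*n} (\<lambda>_. M))"
  proof (rule nn_integral_PiM_reindex[OF M(1)])
    show "inj_on s {..<2*n}" by (metis inj_on_inverseI s_s)
    have "j < n" if "j \<in> S" for j using assms that by auto
    then show "s \<in> {..<2*n} \<rightarrow> {..<2*n}" by (fastforce simp: s_def)
  qed (rule measurable_signed_sup)
  also have "\<dots> = (\<integral>\<^sup>+ w. signed_sup H n S w \<partial>PiM {..<2*n} (\<lambda>_. M))"
  proof (rule nn_integral_cong)
    fix w :: "nat \<Rightarrow> 'a"
    have "(\<Sum>i<n. sign_of {} i * (h ((\<lambda>i\<in>{..<2*n}. w (s i)) (n + i)) - h ((\<lambda>i\<in>{..<2*n}. w (s i)) i)))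
        = (\<Sum>i<n. sign_of S i * (h (w (n + i)) - h (w i)))" for h :: "'a \<Rightarrow> real"
    proof (rule sum.cong[OF refl])
      fix i assume "i \<in> {..<n}"
      moreover have "n + i \<notin> S" using assms by auto
      ultimately show "sign_of {} i * (h ((\<lambda>i\<in>{..<2*n}. w (s i)) (n + i)) - h ((\<lambda>i\<in>{..<2*n}. w (s i)) i))
          = sign_of S i * (h (w (n + i)) - h (w i))"
        by (auto simp: sign_of_def s_def)
    qed
    then show "signed_sup H n {} (\<lambda>i\<in>{..<2*n}. w (s i)) = signed_sup H n S w"
      by (simp only: signed_sup_def)
  qed
  finally show ?thesis .
qed

text \<open>
  For a fixed double sample the class may be replaced by a net of mesh \<open>2B/n\<close>. Each of the \<open>n\<close>
  summands changes by at most twice the mesh, which gives the additive \<open>4B\<close>.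
\<close>

lemma sum_signed_sup_le:
  assumes "B > 0" "n \<ge> 2" "Pdim H = enat k" "k \<ge> 1" "H \<noteq> {}"
  shows "(\<Sum>S\<in>Pow {..<n}. signed_sup H n S w) \<le> 2 ^ n * ennreal (11 * B * sqrt (real k * (ln (real n) / real n)))"
proof -
  have "\<exists>H0\<subseteq>H. finite H0 \<and> card H0 \<le> (2 * n * n + 1) ^ k \<and>
      (\<forall>h\<in>H. \<exists>h'\<in>H0. \<forall>i<2*n. \<bar>h (w i) - h' (w i)\<bar> \<le> 2 * B / real n)"
    using assms bd by (intro Pdim_finite_net) auto
  then obtain H0 where H0: "H0 \<subseteq> H" "finite H0" "card H0 \<le> (2 * n * n + 1) ^ k"
    "\<And>h. h \<in> H \<Longrightarrow> \<exists>h'\<in>H0. \<forall>i<2*n. \<bar>h (w i) - h' (w i)\<bar> \<le> 2 * B / real n"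
    by blast
  have "H0 \<noteq> {}" using H0(4) \<open>H \<noteq> {}\<close> by blast
  define v where "v h i = h (w (n + i)) - h (w i)" for h :: "'a \<Rightarrow> real" and i
  define T where "T S h = (\<Sum>i<n. sign_of S i * v h i)" for S h
  define u where "u S = max 0 (Max (T S ` H0))" for S
  define L where "L = 5 * real k * ln (real n)"
  have Lpos: "L > 0" using assms by (simp add: L_def)
  have sup_le: "signed_sup H n S w \<le> ennreal ((u S + 4 * B) / real n)" for S
    unfolding signed_sup_def
  proof (rule SUP_least)
    fix h assume "h \<in> H"
    then obtain h' where h': "h' \<in> H0" "\<And>i. i < 2 * n \<Longrightarrow> \<bar>h (w i) - h' (w i)\<bar> \<le> 2 * B / real n"
      using H0(4) by blast
    have "T S h - T S h' = (\<Sum>i<n. sign_of S i * (v h i - v h' i))"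
      by (simp add: T_def sum_subtractf right_diff_distrib)
    also have "\<dots> \<le> (\<Sum>i<n. 4 * B / real n)"
    proof (rule sum_mono)
      fix i assume i: "i \<in> {..<n}"
      have "sign_of S i * (v h i - v h' i) \<le> \<bar>v h i - v h' i\<bar>"
        by (auto simp: sign_of_def)
      also have "\<dots> \<le> \<bar>h (w (n + i)) - h' (w (n + i))\<bar> + \<bar>h (w i) - h' (w i)\<bar>"
        unfolding v_def by linarith
      also have "\<dots> \<le> 2 * B / real n + 2 * B / real n"
        using i by (intro add_mono h') auto
      finally show "sign_of S i * (v h i - v h' i) \<le> 4 * B / real n" by simp
    qed
    also have "\<dots> = 4 * B" using assms by simp
    finally have "T S h \<le> T S h' + 4 * B" by simp
    also have "T S h' \<le> u S"
      unfolding u_def using H0(2) h'(1) by (intro max.coboundedI2 Max_ge) auto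
    finally show "ennreal ((\<Sum>i<n. sign_of S i * (h (w (n + i)) - h (w i))) / real n)
        \<le> ennreal ((u S + 4 * B) / real n)"
      unfolding T_def v_def by (intro ennreal_leI divide_right_mono) auto
  qed
  have "(\<Sum>S\<in>Pow {..<n}. u S) \<le> 2 ^ n * (2 * B * sqrt (2 * L * real n))"
  proof (rule massart_signs[where H = H0 and v = v])
    show "\<bar>v h i\<bar> \<le> 2 * B" if "h \<in> H0" for h i
      using bd[of h "w (n + i)"] bd[of h "w i"] that H0(1) unfolding v_def by fastforce
    show "u S \<le> 0 \<or> (\<exists>h\<in>H0. u S \<le> (\<Sum>i<n. sign_of S i * v h i))" for S
    proof -
      have "Max (T S ` H0) \<in> T S ` H0" using H0(2) \<open>H0 \<noteq> {}\<close> by (intro Max_in) auto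
      then obtain h where "h \<in> H0" "Max (T S ` H0) = T S h" by auto
      then show ?thesis unfolding u_def T_def by fastforce
    qed
    have "card H0 + 1 \<le> n ^ (5 * k)"
      using net_size_le_power[of n k] assms H0(3) by linarith
    then have "real (card H0 + 1) \<le> real n ^ (5 * k)"
      by (metis of_nat_le_iff of_nat_power)
    then have "ln (real (card H0 + 1)) \<le> ln (real n ^ (5 * k))"
      using assms by (subst ln_le_cancel_iff) auto
    then show "ln (real (card H0 + 1)) \<le> L"
      using assms by (simp add: L_def ln_realpow)
  qed (use H0 assms Lpos in auto)
  \<comment> \<open>Here \<open>2 * sqrt 10 < 7\<close>, and the discretization error \<open>4B\<close> is absorbed because
    \<open>1 \<le> n * sqrt (k * ln n / n)\<close>; this leaves the constant \<open>11 = 7 + 4\<close>.\<close>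
  also have "2 * B * sqrt (2 * L * real n) \<le> real n * (11 * B * sqrt (real k * (ln (real n) / real n))) - 4 * B"
  proof -
    define q where "q = sqrt (real k * (ln (real n) / real n))"
    have lnn: "ln (real n) \<ge> 1 / 2"
    proof -
      have "1 / 2 \<le> ln (2::real)" using ln2_ge_two_thirds by simp
      also have "\<dots> \<le> ln (real n)" using assms by simp
      finally show ?thesis .
    qed
    have "sqrt (2 * L * real n) = sqrt 10 * (real n * q)"
    proof -
      have "2 * L * real n = 10 * ((real n)\<^sup>2 * (real k * (ln (real n) / real n)))"
        using assms by (simp add: L_def power2_eq_square)
      then show ?thesis by (simp only: q_def real_sqrt_mult real_sqrt_abs abs_of_nat)
    qed
    moreover have "sqrt 10 \<le> 3.5" by (rule real_le_lsqrt) (auto simp: power2_eq_square)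
    moreover have nq: "1 \<le> real n * q"
    proof -
      have "1 \<le> real n * ln (real n)"
        using lnn assms mult_mono[of 2 "real n" "1/2" "ln (real n)"] by simp
      also have "\<dots> \<le> real k * (real n * ln (real n))"
        using assms lnn mult_right_mono[of 1 "real k" "real n * ln (real n)"] by simp
      also have "\<dots> = (real n)\<^sup>2 * (real k * (ln (real n) / real n))"
        using assms by (simp add: power2_eq_square)
      finally have "1 \<le> sqrt ((real n)\<^sup>2 * (real k * (ln (real n) / real n)))" by simp
      then show ?thesis by (simp only: q_def real_sqrt_mult real_sqrt_abs abs_of_nat)
    qed
    ultimately have "2 * sqrt (2 * L * real n) \<le> 7 * (real n * q)"
      using mult_right_mono[of "sqrt 10" "3.5" "real n * q"] by simp
    then have "2 * sqrt (2 * L * real n) \<le> 11 * (real n * q) - 4" using nq by linarith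
    then have "B * (2 * sqrt (2 * L * real n)) \<le> B * (11 * (real n * q) - 4)"
      using assms by (intro mult_left_mono) auto
    then show ?thesis by (simp add: q_def algebra_simps)
  qed
  finally have u_sum: "(\<Sum>S\<in>Pow {..<n}. u S)
      \<le> 2 ^ n * (real n * (11 * B * sqrt (real k * (ln (real n) / real n))) - 4 * B)" by simp
  have "(\<Sum>S\<in>Pow {..<n}. signed_sup H n S w) \<le> (\<Sum>S\<in>Pow {..<n}. ennreal ((u S + 4 * B) / real n))"
    by (intro sum_mono sup_le)
  also have "\<dots> = ennreal (\<Sum>S\<in>Pow {..<n}. (u S + 4 * B) / real n)"
    using assms by (intro sum_ennreal) (auto simp: u_def)
  also have "(\<Sum>S\<in>Pow {..<n}. (u S + 4 * B) / real n) = ((\<Sum>S\<in>Pow {..<n}. u S) + 2 ^ n * (4 * B)) / real n"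
    by (simp add: sum_divide_distrib[symmetric] sum.distrib card_Pow)
  also have "\<dots> \<le> (2 ^ n * (real n * (11 * B * sqrt (real k * (ln (real n) / real n))) - 4 * B) + 2 ^ n * (4 * B)) / real n"
    using u_sum by (intro divide_right_mono add_right_mono) auto
  also have "\<dots> = 2 ^ n * (11 * B * sqrt (real k * (ln (real n) / real n)))"
    using assms by (simp add: field_simps)
  also have "ennreal \<dots> = 2 ^ n * ennreal (11 * B * sqrt (real k * (ln (real n) / real n)))"
    using assms by (simp add: ennreal_mult ennreal_power[symmetric])
  finally show ?thesis using ennreal_leI by simp
qed

text \<open>
  Averaging over all \<open>2\<^sup>n\<close> swaps turns the symmetrized supremum into a Rademacher average,
  which is bounded for each double sample separately.
\<close>

lemma expected_deviation_le:
  assumes "B > 0" "n \<ge> 2" "Pdim H = enat k" "k \<ge> 1" "H \<noteq> {}"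
  shows "(\<integral>\<^sup>+ w. deviation H n M w \<partial>PiM {..<n} (\<lambda>_. M)) \<le> ennreal (11 * B * sqrt (real k * (ln (real n) / real n)))"
proof -
  let ?P = "PiM {..<2*n} (\<lambda>_. M)" and ?K = "ennreal (11 * B * sqrt (real k * (ln (real n) / real n)))"
  interpret P: prob_space ?P using M(1) by (intro prob_space_PiM)
  have "2 ^ n * (\<integral>\<^sup>+ w. deviation H n M w \<partial>PiM {..<n} (\<lambda>_. M)) \<le> 2 ^ n * (\<integral>\<^sup>+ w. signed_sup H n {} w \<partial>?P)"
    using assms by (intro mult_left_mono symmetrization) auto
  also have "\<dots> = (\<Sum>S\<in>Pow {..<n}. \<integral>\<^sup>+ w. signed_sup H n {} w \<partial>?P)"
    by (simp add: card_Pow)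
  also have "\<dots> = (\<Sum>S\<in>Pow {..<n}. \<integral>\<^sup>+ w. signed_sup H n S w \<partial>?P)"
    by (intro sum.cong refl nn_integral_signed_sup_swap) auto
  also have "\<dots> = (\<integral>\<^sup>+ w. (\<Sum>S\<in>Pow {..<n}. signed_sup H n S w) \<partial>?P)"
    by (intro nn_integral_sum[symmetric] measurable_signed_sup)
  also have "\<dots> \<le> (\<integral>\<^sup>+ w. 2 ^ n * ?K \<partial>?P)"
    by (intro nn_integral_mono sum_signed_sup_le assms)
  also have "\<dots> = 2 ^ n * ?K" by (simp add: P.emeasure_space_1)
  finally have "2 ^ n * (\<integral>\<^sup>+ w. deviation H n M w \<partial>PiM {..<n} (\<lambda>_. M)) \<le> 2 ^ n * ?K" .
  moreover have "(2::ennreal) ^ n \<noteq> 0" "(2::ennreal) ^ n \<noteq> \<top>" by (simp_all add: power_eq_top_ennreal)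
  ultimately show ?thesis using ennreal_mult_le_mult_iff by blast
qed

end

lemma ennreal_sqrt_mono: "a \<le> b \<Longrightarrow> ennreal_sqrt a \<le> ennreal_sqrt b"
  unfolding ennreal_sqrt_def
  by (auto intro!: ennreal_leI enn2real_mono simp: top.not_eq_extremum top_unique)

lemma ennreal_sqrt_ennreal: "x \<ge> 0 \<Longrightarrow> ennreal_sqrt (ennreal x) = ennreal (sqrt x)"
  by (simp add: ennreal_sqrt_def)

text \<open>
  Pseudo-dimension \<open>0\<close> is treated apart: the rate vanishes, but so does every member of a symmetric
  class.
\<close>

lemma expected_deviation_le_Pdim:
  fixes M :: "'a::second_countable_topology measure" and H :: "('a \<Rightarrow> real) set"
  assumes M: "prob_space M" "sets M = sets borel"
    and cont: "\<And>h. h \<in> H \<Longrightarrow> continuous_on UNIV h"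
    and bd: "\<And>h x. h \<in> H \<Longrightarrow> \<bar>h x\<bar> \<le> B"
    and sym: "\<And>h. h \<in> H \<Longrightarrow> (\<lambda>x. - h x) \<in> H"
    and "B > 0" "n \<ge> 2"
  shows "(\<integral>\<^sup>+ w. deviation H n M w \<partial>PiM {..<n} (\<lambda>_. M))
    \<le> ennreal (11 * B) * ennreal_sqrt (ennreal_of_enat (Pdim H) * ennreal (ln (real n) / real n))"
proof (cases "H = {}")
  case True
  then show ?thesis by (simp add: deviation_def bot_ennreal)
next
  case False
  have rate: "ln (real n) / real n > 0" using assms by simp
  show ?thesis
  proof (cases "Pdim H")
    case (enat k)
    show ?thesis
    proof (cases "k = 0")
      case True
      have zero: "h = (\<lambda>x. 0)" if "h \<in> H" for h
      proof
        fix x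
        have "h = (\<lambda>x. - h x)" using Pdim_zero_unique[OF _ that sym[OF that]] enat True by (simp add: zero_enat_def)
        then have "h x = - h x" by (rule fun_cong)
        then show "h x = 0" by simp
      qed
      have "deviation H n M w \<le> 0" for w
        unfolding deviation_def
      proof (rule SUP_least)
        fix h assume "h \<in> H"
        then have "h = (\<lambda>x. 0)" by (rule zero)
        then show "ennreal ((\<integral>x. h x \<partial>M) - empirical_mean n w h) \<le> 0"
          by (simp add: empirical_mean_def)
      qed
      then show ?thesis by simp
    next
      case False
      have rk: "0 \<le> real k * (ln (real n) / real n)" using rate by (intro mult_nonneg_nonneg) simp_all
      have "(\<integral>\<^sup>+ w. deviation H n M w \<partial>PiM {..<n} (\<lambda>_. M)) \<le> ennreal (11 * B * sqrt (real k * (ln (real n) / real n)))"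
      proof (rule expected_deviation_le)
        show "1 \<le> k" using False by simp
        show "\<bar>h x\<bar> \<le> B" if "h \<in> H" for h x using that by (rule bd)
        show "continuous_on UNIV h" if "h \<in> H" for h using that by (rule cont)
      qed (fact M enat \<open>H \<noteq> {}\<close> \<open>B > 0\<close> \<open>n \<ge> 2\<close>)+
      also have "\<dots> = ennreal (11 * B) * ennreal_sqrt (ennreal (real k * (ln (real n) / real n)))"
        unfolding ennreal_sqrt_ennreal[OF rk] using \<open>B > 0\<close> rk by (intro ennreal_mult) simp_all
      also have "ennreal (real k * (ln (real n) / real n)) = ennreal_of_enat (Pdim H) * ennreal (ln (real n) / real n)"
        unfolding enat ennreal_of_enat_enat ennreal_of_nat_eq_real_of_nat
        using rate by (intro ennreal_mult) simp_all
      finally show ?thesis .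
    qed
  next
    case infinity
    then have "ennreal_of_enat (Pdim H) * ennreal (ln (real n) / real n) = \<infinity>"
      using \<open>n \<ge> 2\<close> by (simp add: ennreal_top_mult)
    then show ?thesis using \<open>B > 0\<close> by (simp add: ennreal_sqrt_def ennreal_mult_top)
  qed
qed

section \<open>Transport and entropy inequalities\<close>

text \<open>
  Sub-Gaussianity with variance proxy \<open>c\<close> of \<open>h(X) - h(Y)\<close> for independent \<open>X, Y\<close> of law \<open>M\<close>.
  With two copies in place of the centred variable no mean of \<open>h\<close> occurs in the definition, and the
  symmetry between the copies turns exponentials into \<open>cosh\<close>.
\<close>

definition subgaussian_diff :: "'a measure \<Rightarrow> ('a \<Rightarrow> real) \<Rightarrow> real \<Rightarrow> bool" where
  "subgaussian_diff M h c \<longleftrightarrow>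
     (\<forall>t. (\<integral>\<^sup>+y. \<integral>\<^sup>+x. ennreal (exp (t * (h x - h y))) \<partial>M \<partial>M) \<le> ennreal (exp (c * t\<^sup>2 / 2)))"

lemma young_exp_ln:
  fixes p u :: real
  assumes "p > 0"
  shows "p * u \<le> p * ln p - p + exp u"
proof -
  have "p * (1 + (u - ln p)) \<le> p * exp (u - ln p)"
    using assms by (intro mult_left_mono exp_ge_add_one_self) auto
  also have "p * exp (u - ln p) = exp u" using assms by (simp add: exp_diff)
  finally show ?thesis by (simp add: algebra_simps)
qed

text \<open>
  The variational inequality for the entropy of \<open>r dM\<close>, obtained by integrating Young's inequality
  \<open>p u \<le> p ln p - p + exp u\<close> with \<open>p = r(x)\<close> and \<open>u = t (h(x) - h(y)) - c t\<^sup>2/2\<close> over two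
  independent copies: the exponential term then has mean at most \<open>1\<close>.
\<close>

lemma (in prob_space) transport_linear:
  fixes h r :: "'a \<Rightarrow> real"
  assumes [measurable]: "h \<in> borel_measurable M" "r \<in> borel_measurable M"
    and pos: "AE x in M. 0 < r x"
    and int: "integrable M h" "integrable M r" "integrable M (\<lambda>x. r x * h x)" "integrable M (\<lambda>x. r x * ln (r x))"
    and one: "expectation r = 1"
    and sub: "subgaussian_diff M h c"
  shows "t * (expectation (\<lambda>x. r x * h x) - expectation h) \<le> expectation (\<lambda>x. r x * ln (r x)) + c * t\<^sup>2 / 2"
proof -
  define K where "K = expectation (\<lambda>x. r x * ln (r x))"
  define m where "m = expectation (\<lambda>x. r x * h x)"
  define k where "k = c * t\<^sup>2 / 2"
  have inner: "ennreal (t * m - t * h y - k - K + 1) \<le> (\<integral>\<^sup>+x. ennreal (exp (t * (h x - h y) - k)) \<partial>M)" for y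
  proof (cases "(\<integral>\<^sup>+x. ennreal (exp (t * (h x - h y) - k)) \<partial>M) = \<infinity>")
    case False
    have ie: "integrable M (\<lambda>x. exp (t * (h x - h y) - k))"
      by (rule integrableI_nonneg) (use False in \<open>auto simp: top.not_eq_extremum\<close>)
    have "expectation (\<lambda>x. r x * (t * (h x - h y) - k)) \<le> expectation (\<lambda>x. r x * ln (r x) - r x + exp (t * (h x - h y) - k))"
    proof (rule integral_mono_AE)
      have "integrable M (\<lambda>x. t * (r x * h x) - (t * h y + k) * r x)" using int by simp
      then show "integrable M (\<lambda>x. r x * (t * (h x - h y) - k))" by (simp add: algebra_simps)
      show "integrable M (\<lambda>x. r x * ln (r x) - r x + exp (t * (h x - h y) - k))" using int ie by simp
      show "AE x in M. r x * (t * (h x - h y) - k) \<le> r x * ln (r x) - r x + exp (t * (h x - h y) - k)"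
        using pos by eventually_elim (rule young_exp_ln)
    qed
    also have "expectation (\<lambda>x. r x * (t * (h x - h y) - k)) = expectation (\<lambda>x. t * (r x * h x) - (t * h y + k) * r x)"
      by (simp add: algebra_simps)
    also have "\<dots> = t * m - (t * h y + k)" using int one by (simp add: m_def)
    also have "expectation (\<lambda>x. r x * ln (r x) - r x + exp (t * (h x - h y) - k)) = K - 1 + expectation (\<lambda>x. exp (t * (h x - h y) - k))"
      using int ie one by (simp add: K_def)
    finally have "t * m - t * h y - k - K + 1 \<le> expectation (\<lambda>x. exp (t * (h x - h y) - k))" by simp
    then have "ennreal (t * m - t * h y - k - K + 1) \<le> ennreal (expectation (\<lambda>x. exp (t * (h x - h y) - k)))"
      by (rule ennreal_leI)
    also have "\<dots> = (\<integral>\<^sup>+x. ennreal (exp (t * (h x - h y) - k)) \<partial>M)"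
      using ie by (intro nn_integral_eq_integral[symmetric]) auto
    finally show ?thesis .
  qed simp
  have "t * m - t * expectation h - k - K + 1 = expectation (\<lambda>y. t * m - t * h y - k - K + 1)"
    using int by (simp add: prob_space)
  also have "ennreal \<dots> \<le> (\<integral>\<^sup>+y. ennreal (t * m - t * h y - k - K + 1) \<partial>M)"
    using int by (intro ennreal_integral_le_nn_integral) auto
  also have "\<dots> \<le> (\<integral>\<^sup>+y. \<integral>\<^sup>+x. ennreal (exp (t * (h x - h y) - k)) \<partial>M \<partial>M)"
    by (intro nn_integral_mono inner)
  also have "\<dots> = (\<integral>\<^sup>+y. \<integral>\<^sup>+x. ennreal (exp (- k)) * ennreal (exp (t * (h x - h y))) \<partial>M \<partial>M)"
    by (simp add: ennreal_mult[symmetric] exp_add[symmetric])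
  also have "\<dots> = ennreal (exp (- k)) * (\<integral>\<^sup>+y. \<integral>\<^sup>+x. ennreal (exp (t * (h x - h y))) \<partial>M \<partial>M)"
    by (simp add: nn_integral_cmult)
  also have "\<dots> \<le> ennreal (exp (- k)) * ennreal (exp k)"
    using sub unfolding subgaussian_diff_def k_def by (intro mult_left_mono) auto
  also have "\<dots> = ennreal 1" by (simp add: ennreal_mult[symmetric] exp_add[symmetric])
  finally have "t * m - t * expectation h - k - K + 1 \<le> 1" by (simp add: ennreal_le_iff)
  then show ?thesis by (simp add: m_def K_def k_def algebra_simps)
qed

text \<open>
  The linear inequality at its optimal \<open>t\<close>, the difference of the means divided by \<open>c\<close>.
\<close>

lemma (in prob_space) transport_square:
  fixes h r :: "'a \<Rightarrow> real"
  assumes "h \<in> borel_measurable M" "r \<in> borel_measurable M"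
    and "AE x in M. 0 < r x"
    and "integrable M h" "integrable M r" "integrable M (\<lambda>x. r x * h x)" "integrable M (\<lambda>x. r x * ln (r x))"
    and "expectation r = 1"
    and "subgaussian_diff M h c" "c > 0"
  shows "(expectation (\<lambda>x. r x * h x) - expectation h)\<^sup>2 \<le> 2 * c * expectation (\<lambda>x. r x * ln (r x))"
proof -
  define D where "D = expectation (\<lambda>x. r x * h x) - expectation h"
  have "(D / c) * D \<le> expectation (\<lambda>x. r x * ln (r x)) + c * (D / c)\<^sup>2 / 2"
    unfolding D_def by (rule transport_linear) (use assms in auto)
  then show ?thesis using \<open>c > 0\<close> unfolding D_def[symmetric]
    by (simp add: field_simps power2_eq_square)
qed

text \<open>
  From \<open>ln r \<le> r - 1\<close> the mean of \<open>ln r\<close> under \<open>M\<close> is at most \<open>0\<close>, so subtracting it increases the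
  entropy to the symmetrized one, \<open>\<integral>ln r (r - 1) dM\<close>. In it \<open>ln r\<close> may be exchanged for \<open>f\<close> at the price
  \<open>a\<close> under each of the two probability measures.
\<close>

lemma (in prob_space) relative_entropy_le:
  fixes f r :: "'a \<Rightarrow> real"
  assumes [measurable]: "f \<in> borel_measurable M" "r \<in> borel_measurable M"
    and r: "AE x in M. 0 < r x \<and> \<bar>ln (r x) - f x\<bar> \<le> a" "integrable M r" "expectation r = 1"
    and f: "\<And>x. \<bar>f x\<bar> \<le> B"
  shows "integrable M (\<lambda>x. r x * ln (r x))"
    and "expectation (\<lambda>x. r x * ln (r x)) \<le> expectation (\<lambda>x. r x * f x) - expectation f + 2 * a"
proof -
  have lnr: "AE x in M. \<bar>ln (r x)\<bar> \<le> a + B"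
    using r(1) by eventually_elim (use f in \<open>smt (verit)\<close>)
  show i1: "integrable M (\<lambda>x. r x * ln (r x))"
  proof (rule Bochner_Integration.integrable_bound)
    show "integrable M (\<lambda>x. (a + B) * r x)" using r by simp
    show "AE x in M. norm (r x * ln (r x)) \<le> norm ((a + B) * r x)"
      using lnr r(1)
    proof eventually_elim
      case (elim x)
      have "\<bar>r x\<bar> * \<bar>ln (r x)\<bar> \<le> \<bar>r x\<bar> * \<bar>a + B\<bar>" using elim by (intro mult_left_mono) auto
      then show ?case by (simp add: abs_mult mult.commute)
    qed
  qed simp
  have i2: "integrable M (\<lambda>x. r x * f x)"
  proof (rule Bochner_Integration.integrable_bound)
    show "integrable M (\<lambda>x. B * r x)" using r by simp
    show "AE x in M. norm (r x * f x) \<le> norm (B * r x)"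
    proof (rule AE_I2)
      fix x
      have "\<bar>r x\<bar> * \<bar>f x\<bar> \<le> \<bar>r x\<bar> * \<bar>B\<bar>" using f[of x] by (intro mult_left_mono) auto
      then show "norm (r x * f x) \<le> norm (B * r x)" by (simp add: abs_mult mult.commute)
    qed
  qed simp
  have i3: "integrable M (\<lambda>x. ln (r x))"
    using lnr by (intro integrable_const_bound[of _ "a + B"]) auto
  have i4: "integrable M f" using f by (intro integrable_const_bound[of _ B]) auto
  have "expectation (\<lambda>x. ln (r x)) \<le> expectation (\<lambda>x. r x - 1)"
    using i3 r by (intro integral_mono_AE) (auto elim!: eventually_mono intro: ln_le_minus_one)
  also have "\<dots> = 0" using r by (simp add: prob_space)
  finally have "expectation (\<lambda>x. r x * ln (r x)) \<le> expectation (\<lambda>x. r x * ln (r x)) - expectation (\<lambda>x. ln (r x))" by simp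
  also have "\<dots> \<le> (expectation (\<lambda>x. r x * f x) + a) - (expectation f - a)"
  proof (rule diff_mono)
    have "expectation (\<lambda>x. r x * ln (r x)) \<le> expectation (\<lambda>x. r x * f x + a * r x)"
    proof (rule integral_mono_AE)
      show "AE x in M. r x * ln (r x) \<le> r x * f x + a * r x"
        using r(1)
      proof eventually_elim
        case (elim x)
        then have "r x * (ln (r x) - f x) \<le> r x * a" by (intro mult_left_mono) auto
        then show ?case by (simp add: algebra_simps)
      qed
    qed (use i1 i2 r in auto)
    also have "\<dots> = expectation (\<lambda>x. r x * f x) + a" using i2 r by simp
    finally show "expectation (\<lambda>x. r x * ln (r x)) \<le> expectation (\<lambda>x. r x * f x) + a" .
    have "expectation f - a = expectation (\<lambda>x. f x - a)" using i4 by (simp add: prob_space)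
    also have "\<dots> \<le> expectation (\<lambda>x. ln (r x))"
    proof (rule integral_mono_AE)
      show "AE x in M. f x - a \<le> ln (r x)" using r(1) by eventually_elim auto
    qed (use i4 i3 in auto)
    finally show "expectation f - a \<le> expectation (\<lambda>x. ln (r x))" .
  qed
  finally show "expectation (\<lambda>x. r x * ln (r x)) \<le> expectation (\<lambda>x. r x * f x) - expectation f + 2 * a" by simp
qed

lemma transport_log_ratio:
  fixes f h r :: "'a \<Rightarrow> real"
  assumes M: "prob_space M" and N: "prob_space N" and NM: "N = density M (\<lambda>x. ennreal (r x))"
    and [measurable]: "r \<in> borel_measurable M" "f \<in> borel_measurable M" "h \<in> borel_measurable M"
    and r: "AE x in M. 0 < r x \<and> \<bar>ln (r x) - f x\<bar> \<le> a"
    and f: "\<And>x. \<bar>f x\<bar> \<le> B"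
    and h: "integrable M h" "integrable N h" "subgaussian_diff M h c" "c > 0"
  shows "((\<integral>x. h x \<partial>N) - (\<integral>x. h x \<partial>M))\<^sup>2 \<le> 2 * c * ((\<integral>x. f x \<partial>N) - (\<integral>x. f x \<partial>M) + 2 * a)"
proof -
  interpret M: prob_space M by fact
  interpret N: prob_space N by fact
  have r0: "AE x in M. 0 \<le> r x" using r by eventually_elim auto
  have "integrable N (\<lambda>_. 1::real)" by simp
  then have ir: "integrable M r" unfolding NM using r0 by (subst (asm) integrable_density) auto
  have "(\<integral>x. 1 \<partial>N) = (1::real)" by (simp add: N.prob_space)
  then have r1: "(\<integral>x. r x \<partial>M) = 1" unfolding NM using r0 by (subst (asm) integral_density) auto
  have irh: "integrable M (\<lambda>x. r x * h x)" using h(2) r0 unfolding NM by (subst (asm) integrable_density) auto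
  have e: "(\<integral>x. k x \<partial>N) = (\<integral>x. r x * k x \<partial>M)" if [measurable]: "k \<in> borel_measurable M" for k :: "'a \<Rightarrow> real"
    unfolding NM using r0 by (subst integral_density) auto
  note ent = M.relative_entropy_le[OF _ _ r ir r1 f]
  have "((\<integral>x. r x * h x \<partial>M) - (\<integral>x. h x \<partial>M))\<^sup>2 \<le> 2 * c * (\<integral>x. r x * ln (r x) \<partial>M)"
    using r by (intro M.transport_square h ir r1 irh ent(1)) (auto elim!: eventually_mono)
  also have "\<dots> \<le> 2 * c * ((\<integral>x. r x * f x \<partial>M) - (\<integral>x. f x \<partial>M) + 2 * a)"
    using h(4) by (intro mult_left_mono ent(2)) auto
  finally show ?thesis by (simp add: e)
qed

section \<open>Sub-Gaussian inputs\<close>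

lemma borel_measurable_same_sets:
  "sets M = sets borel \<Longrightarrow> f \<in> borel_measurable borel \<Longrightarrow> f \<in> borel_measurable M"
  using measurable_cong_sets by blast

lemma borel_measurable_vec_nth: "(\<lambda>x :: real ^ 'd. x $ i) \<in> borel_measurable borel"
  by (intro borel_measurable_continuous_onI continuous_intros)

lemma borel_measurable_cosh [measurable]: "(cosh :: real \<Rightarrow> real) \<in> borel_measurable borel"
  by (intro borel_measurable_continuous_onI continuous_intros)

lemma ennreal_cosh: "ennreal (cosh u) = ennreal (1 / 2) * ennreal (exp u) + ennreal (1 / 2) * ennreal (exp (- u))"
proof -
  have "ennreal (cosh u) = ennreal (1 / 2 * exp u + 1 / 2 * exp (- u))"
    by (simp add: cosh_field_def add_divide_distrib)
  also have "\<dots> = ennreal (1 / 2 * exp u) + ennreal (1 / 2 * exp (- u))" by (rule ennreal_plus) auto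
  also have "\<dots> = ennreal (1 / 2) * ennreal (exp u) + ennreal (1 / 2) * ennreal (exp (- u))"
    by (subst (1 2) ennreal_mult) auto
  finally show ?thesis .
qed

text \<open>
  The factorization shows that the moment generating function of the difference is even in \<open>t\<close>.
\<close>

lemma nn_integral_exp_diff:
  fixes h :: "'a \<Rightarrow> real"
  assumes [measurable]: "h \<in> borel_measurable M"
  shows "(\<integral>\<^sup>+y. \<integral>\<^sup>+x. ennreal (exp (t * (h x - h y))) \<partial>M \<partial>M)
    = (\<integral>\<^sup>+x. ennreal (exp (t * h x)) \<partial>M) * (\<integral>\<^sup>+y. ennreal (exp (- t * h y)) \<partial>M)"
proof -
  have "ennreal (exp (t * (h x - h y))) = ennreal (exp (t * h x)) * ennreal (exp (- t * h y))" for x y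
    by (simp add: ennreal_mult[symmetric] exp_add[symmetric] algebra_simps)
  then show ?thesis by (simp add: nn_integral_multc nn_integral_cmult)
qed

lemma (in sigma_finite_measure) nn_integral_exp_diff_eq_cosh:
  fixes h :: "'a \<Rightarrow> real"
  assumes [measurable]: "h \<in> borel_measurable M"
  shows "(\<integral>\<^sup>+y. \<integral>\<^sup>+x. ennreal (exp (t * (h x - h y))) \<partial>M \<partial>M)
    = (\<integral>\<^sup>+y. \<integral>\<^sup>+x. ennreal (cosh (t * (h x - h y))) \<partial>M \<partial>M)"
proof -
  define I where "I t = (\<integral>\<^sup>+y. \<integral>\<^sup>+x. ennreal (exp (t * (h x - h y))) \<partial>M \<partial>M)" for t
  have "I t = I (- t)"
    unfolding I_def using nn_integral_exp_diff[of h M t] nn_integral_exp_diff[of h M "- t"]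
    by (simp add: mult.commute)
  moreover have half: "ennreal (1 / 2) + ennreal (1 / 2) = 1" by (subst ennreal_plus[symmetric]) auto
  ultimately have "I t = ennreal (1 / 2) * I t + ennreal (1 / 2) * I (- t)"
    by (metis distrib_right mult_1)
  also have "\<dots> = (\<integral>\<^sup>+y. \<integral>\<^sup>+x. ennreal (1 / 2) * ennreal (exp (t * (h x - h y))) + ennreal (1 / 2) * ennreal (exp (- t * (h x - h y))) \<partial>M \<partial>M)"
    unfolding I_def by (simp add: nn_integral_add nn_integral_cmult)
  also have "\<dots> = (\<integral>\<^sup>+y. \<integral>\<^sup>+x. ennreal (cosh (t * (h x - h y))) \<partial>M \<partial>M)"
    by (intro nn_integral_cong) (simp only: ennreal_cosh mult_minus_left)
  finally show ?thesis by (simp add: I_def)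
qed

lemma (in prob_space) subgaussian_diff_bounded:
  fixes h :: "'a \<Rightarrow> real"
  assumes [measurable]: "h \<in> borel_measurable M" and b: "AE x in M. AE y in M. \<bar>h x - h y\<bar> \<le> b"
  shows "subgaussian_diff M h (b\<^sup>2)"
  unfolding subgaussian_diff_def
proof
  fix t
  have "(\<integral>\<^sup>+y. \<integral>\<^sup>+x. ennreal (exp (t * (h x - h y))) \<partial>M \<partial>M)
    = (\<integral>\<^sup>+y. \<integral>\<^sup>+x. ennreal (cosh (t * (h x - h y))) \<partial>M \<partial>M)"
    by (rule nn_integral_exp_diff_eq_cosh) simp
  also have "\<dots> \<le> (\<integral>\<^sup>+y. \<integral>\<^sup>+x. ennreal (exp (b\<^sup>2 * t\<^sup>2 / 2)) \<partial>M \<partial>M)"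
  proof (rule nn_integral_mono_AE)
    show "AE y in M. (\<integral>\<^sup>+x. ennreal (cosh (t * (h x - h y))) \<partial>M) \<le> (\<integral>\<^sup>+x. ennreal (exp (b\<^sup>2 * t\<^sup>2 / 2)) \<partial>M)"
      using b
    proof eventually_elim
      case (elim y)
      show ?case
      proof (rule nn_integral_mono_AE)
        show "AE x in M. ennreal (cosh (t * (h x - h y))) \<le> ennreal (exp (b\<^sup>2 * t\<^sup>2 / 2))"
          using elim
        proof eventually_elim
          case (elim x)
          have "(h x - h y)\<^sup>2 \<le> b\<^sup>2"
            using elim by (metis abs_minus_commute abs_le_square_iff abs_of_nonneg abs_ge_zero order_trans)
          then have "(t * (h x - h y))\<^sup>2 / 2 \<le> b\<^sup>2 * t\<^sup>2 / 2"
            using mult_left_mono[of "(h x - h y)\<^sup>2" "b\<^sup>2" "t\<^sup>2"] by (simp add: power_mult_distrib mult.commute)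
          then have "cosh (t * (h x - h y)) \<le> exp (b\<^sup>2 * t\<^sup>2 / 2)"
            using cosh_le_exp_half_square order_trans exp_le_cancel_iff by blast
          then show ?case by (rule ennreal_leI)
        qed
      qed
    qed
  qed
  also have "\<dots> = ennreal (exp (b\<^sup>2 * t\<^sup>2 / 2))" by (simp add: emeasure_space_1)
  finally show "(\<integral>\<^sup>+y. \<integral>\<^sup>+x. ennreal (exp (t * (h x - h y))) \<partial>M \<partial>M) \<le> ennreal (exp (b\<^sup>2 * t\<^sup>2 / 2))" .
qed

lemma subgaussian_diff_mono:
  assumes "subgaussian_diff M h c" "c \<le> c'"
  shows "subgaussian_diff M h c'"
  unfolding subgaussian_diff_def
proof
  fix t
  have "exp (c * t\<^sup>2 / 2) \<le> exp (c' * t\<^sup>2 / 2)" using assms(2) by (simp add: mult_right_mono)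
  then show "(\<integral>\<^sup>+y. \<integral>\<^sup>+x. ennreal (exp (t * (h x - h y))) \<partial>M \<partial>M) \<le> ennreal (exp (c' * t\<^sup>2 / 2))"
    using assms(1) unfolding subgaussian_diff_def by (meson ennreal_leI order_trans)
qed

lemma subgaussian_diff_distr:
  assumes [measurable]: "g \<in> measurable M N" "h \<in> borel_measurable N"
    and "subgaussian_diff M (\<lambda>x. h (g x)) c"
  shows "subgaussian_diff (distr M N g) h c"
proof -
  have "(\<integral>\<^sup>+y. \<integral>\<^sup>+x. ennreal (exp (t * (h x - h y))) \<partial>distr M N g \<partial>distr M N g)
      = (\<integral>\<^sup>+y. \<integral>\<^sup>+x. ennreal (exp (t * (h (g x) - h (g y)))) \<partial>M \<partial>M)" for t
    by (subst nn_integral_exp_diff, simp, subst nn_integral_exp_diff[of "\<lambda>x. h (g x)"], simp)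
      (simp add: nn_integral_distr)
  then show ?thesis using assms(3) unfolding subgaussian_diff_def by simp
qed

text \<open>
  Convexity of \<open>exp\<close> at \<open>b\<close> and at \<open>-b\<close>. The average, unlike a bound by the sum, keeps the value
  \<open>1\<close> at \<open>0\<close>, as needed for a sub-Gaussian estimate near \<open>t = 0\<close>.
\<close>

lemma cosh_sum_le_average:
  fixes b :: "'i \<Rightarrow> real"
  assumes "finite I" "I \<noteq> {}"
  shows "cosh (\<Sum>i\<in>I. b i) \<le> (\<Sum>i\<in>I. cosh (real (card I) * b i)) / real (card I)"
proof -
  have *: "exp (\<Sum>i\<in>I. c i) \<le> (\<Sum>i\<in>I. exp (real (card I) * c i)) / real (card I)" for c :: "'i \<Rightarrow> real"
  proof -
    have "card I \<noteq> 0" using assms by simp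
    then show ?thesis
      using convex_on_sum[OF assms exp_convex, of "\<lambda>_. 1 / real (card I)" "\<lambda>i. real (card I) * c i"]
      by (simp add: sum_divide_distrib)
  qed
  have "cosh (\<Sum>i\<in>I. b i) = (exp (\<Sum>i\<in>I. b i) + exp (\<Sum>i\<in>I. - b i)) / 2"
    by (simp add: cosh_field_def sum_negf)
  also have "\<dots> \<le> ((\<Sum>i\<in>I. exp (real (card I) * b i)) / real (card I) + (\<Sum>i\<in>I. exp (real (card I) * - b i)) / real (card I)) / 2"
    by (intro divide_right_mono add_mono *) auto
  also have "\<dots> = (\<Sum>i\<in>I. cosh (real (card I) * b i)) / real (card I)"
    by (simp add: cosh_field_def sum.distrib sum_divide_distrib[symmetric] add_divide_distrib)
  finally show ?thesis .
qed

text \<open>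
  Bounding the Euclidean distance by the sum of the coordinate distances reduces the claim to the
  coordinates. This costs a constant that grows with the dimension and replaces Gaussian
  isoperimetry.
\<close>

lemma subgaussian_diff_lipschitz:
  fixes k :: "real ^ 'd \<Rightarrow> real"
  assumes M: "prob_space M" and sets: "sets M = sets borel"
    and coord: "\<And>i. subgaussian_diff M (\<lambda>x. x $ i) 2"
    and k: "L-lipschitz_on UNIV k"
  shows "subgaussian_diff M k (2 * (real CARD('d) * L)\<^sup>2)"
  unfolding subgaussian_diff_def
proof
  fix t
  interpret prob_space M by fact
  have mk [measurable]: "(\<lambda>x. x $ i) \<in> borel_measurable M" for i
    by (rule borel_measurable_same_sets[OF sets borel_measurable_vec_nth])
  have [measurable]: "k \<in> borel_measurable M"
    by (rule borel_measurable_same_sets[OF sets borel_measurable_continuous_onI[OF lipschitz_on_continuous_on[OF k]]])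
  have L: "L \<ge> 0" using k by (rule lipschitz_on_nonneg)
  define s where "s = real CARD('d) * (t * L)"
  have pt: "cosh (t * (k x - k y)) \<le> (\<Sum>i\<in>UNIV. cosh (s * (x $ i - y $ i))) / real CARD('d)" for x y
  proof -
    have abs_s: "real CARD('d) * (\<bar>t\<bar> * (L * \<bar>x $ i - y $ i\<bar>)) = \<bar>s * (x $ i - y $ i)\<bar>" for i
      using L by (simp add: s_def abs_mult)
    have "\<bar>t * (k x - k y)\<bar> \<le> \<bar>t\<bar> * (L * dist x y)"
      using lipschitz_onD[OF k, of x y] by (simp add: abs_mult dist_real_def mult_left_mono)
    also have "dist x y \<le> (\<Sum>i\<in>UNIV. \<bar>x $ i - y $ i\<bar>)"
      using norm_le_l1_cart[of "x - y"] by (simp add: dist_norm)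
    finally have "\<bar>t * (k x - k y)\<bar> \<le> (\<Sum>i\<in>UNIV. \<bar>t\<bar> * (L * \<bar>x $ i - y $ i\<bar>))"
      using L by (simp add: mult_left_mono sum_distrib_left)
    then have "cosh \<bar>t * (k x - k y)\<bar> \<le> cosh (\<Sum>i\<in>UNIV. \<bar>t\<bar> * (L * \<bar>x $ i - y $ i\<bar>))"
      by (subst cosh_real_nonneg_le_iff) auto
    then have "cosh (t * (k x - k y)) \<le> cosh (\<Sum>i\<in>UNIV. \<bar>t\<bar> * (L * \<bar>x $ i - y $ i\<bar>))"
      by (simp only: cosh_real_abs)
    also have "\<dots> \<le> (\<Sum>i\<in>UNIV. cosh (real CARD('d) * (\<bar>t\<bar> * (L * \<bar>x $ i - y $ i\<bar>)))) / real CARD('d)"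
      by (rule cosh_sum_le_average) auto
    finally show ?thesis by (simp only: abs_s cosh_real_abs)
  qed
  have "(\<integral>\<^sup>+y. \<integral>\<^sup>+x. ennreal (exp (t * (k x - k y))) \<partial>M \<partial>M)
    = (\<integral>\<^sup>+y. \<integral>\<^sup>+x. ennreal (cosh (t * (k x - k y))) \<partial>M \<partial>M)"
    by (rule nn_integral_exp_diff_eq_cosh) simp
  also have "\<dots> \<le> (\<integral>\<^sup>+y. \<integral>\<^sup>+x. (\<Sum>i\<in>UNIV. ennreal (1 / real CARD('d)) * ennreal (cosh (s * (x $ i - y $ i)))) \<partial>M \<partial>M)"
  proof (intro nn_integral_mono)
    fix x y :: "real ^ 'd"
    have "ennreal (cosh (t * (k x - k y))) \<le> ennreal (\<Sum>i\<in>UNIV. 1 / real CARD('d) * cosh (s * (x $ i - y $ i)))"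
      using pt[of x y] by (intro ennreal_leI) (simp add: sum_divide_distrib)
    also have "\<dots> = (\<Sum>i\<in>UNIV. ennreal (1 / real CARD('d)) * ennreal (cosh (s * (x $ i - y $ i))))"
      by (subst sum_ennreal[symmetric]) (simp_all add: ennreal_mult[symmetric])
    finally show "ennreal (cosh (t * (k x - k y))) \<le> (\<Sum>i\<in>UNIV. ennreal (1 / real CARD('d)) * ennreal (cosh (s * (x $ i - y $ i))))" .
  qed
  also have "\<dots> = (\<Sum>i\<in>UNIV. ennreal (1 / real CARD('d)) * (\<integral>\<^sup>+y. \<integral>\<^sup>+x. ennreal (cosh (s * (x $ i - y $ i))) \<partial>M \<partial>M))"
    by (simp add: nn_integral_sum nn_integral_cmult)
  also have "\<dots> \<le> (\<Sum>i\<in>(UNIV :: 'd set). ennreal (1 / real CARD('d)) * ennreal (exp (2 * s\<^sup>2 / 2)))"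
  proof (intro sum_mono mult_left_mono)
    fix i
    show "(\<integral>\<^sup>+y. \<integral>\<^sup>+x. ennreal (cosh (s * (x $ i - y $ i))) \<partial>M \<partial>M) \<le> ennreal (exp (2 * s\<^sup>2 / 2))"
      using coord[of i] nn_integral_exp_diff_eq_cosh[of "\<lambda>x. x $ i" s, OF mk] unfolding subgaussian_diff_def by metis
  qed simp
  also have "\<dots> = ennreal (exp (2 * (real CARD('d) * L)\<^sup>2 * t\<^sup>2 / 2))"
    by (simp add: s_def power_mult_distrib ennreal_mult[symmetric] ennreal_of_nat_eq_real_of_nat mult_ac)
  finally show "(\<integral>\<^sup>+y. \<integral>\<^sup>+x. ennreal (exp (t * (k x - k y))) \<partial>M \<partial>M) \<le> ennreal (exp (2 * (real CARD('d) * L)\<^sup>2 * t\<^sup>2 / 2))" .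
qed

text \<open>
  Completing the square.
\<close>

lemma nn_integral_exp_std_normal:
  "(\<integral>\<^sup>+x. ennreal (std_normal_density x * exp (s * x)) \<partial>lborel) = ennreal (exp (s\<^sup>2 / 2))"
proof -
  have "std_normal_density x * exp (s * x) = exp (s\<^sup>2 / 2) * normal_density s 1 x" for x
    by (simp add: normal_density_def exp_add[symmetric] field_simps power2_eq_square)
  then have "(\<integral>\<^sup>+x. ennreal (std_normal_density x * exp (s * x)) \<partial>lborel)
      = ennreal (exp (s\<^sup>2 / 2)) * (\<integral>\<^sup>+x. ennreal (normal_density s 1 x) \<partial>lborel)"
    by (simp add: ennreal_mult nn_integral_cmult)
  also have "(\<integral>\<^sup>+x. ennreal (normal_density s 1 x) \<partial>lborel) = 1"
    using prob_space.emeasure_space_1[OF prob_space_normal_density[of 1 s]] by (simp add: emeasure_density)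
  finally show ?thesis by simp
qed

lemma nn_integral_exp_std_gaussian:
  fixes i :: "'d::finite"
  shows "(\<integral>\<^sup>+z. ennreal (exp (s * (z $ i))) \<partial>std_gaussian) = ennreal (exp (s\<^sup>2 / 2))"
proof -
  note [measurable] = borel_measurable_vec_nth
  define w where "w b x = (if b = axis i 1 then std_normal_density x * exp (s * x) else std_normal_density x)"
    for b :: "real ^ 'd" and x :: real
  have [measurable]: "w b \<in> borel_measurable borel" for b unfolding w_def[abs_def] by (cases "b = axis i 1") auto
  have wnn: "0 \<le> w b x" for b x by (simp add: w_def)
  have inj: "inj (\<lambda>j :: 'd. axis j (1::real))" by (auto simp: inj_on_def axis_eq_axis)
  have B: "(Basis :: (real ^ 'd) set) = range (\<lambda>j. axis j 1)" by (auto simp: Basis_vec_def)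
  have re: "(\<Prod>b\<in>(Basis :: (real ^ 'd) set). f b) = (\<Prod>j\<in>UNIV. f (axis j 1))" for f :: "real ^ 'd \<Rightarrow> ennreal"
    unfolding B by (simp add: prod.reindex inj)
  have "(\<integral>\<^sup>+z. ennreal (exp (s * (z $ i))) \<partial>std_gaussian)
      = (\<integral>\<^sup>+z. ennreal (\<Prod>j\<in>UNIV. std_normal_density (z $ j)) * ennreal (exp (s * (z $ i))) \<partial>lborel)"
    unfolding std_gaussian_def by (subst nn_integral_density) auto
  also have "\<dots> = (\<integral>\<^sup>+z. (\<Prod>b\<in>Basis. ennreal (w b (z \<bullet> b))) \<partial>lborel)"
  proof (rule nn_integral_cong)
    fix z :: "real ^ 'd"
    have "(\<Prod>b\<in>Basis. ennreal (w b (z \<bullet> b))) = (\<Prod>j\<in>UNIV. ennreal (w (axis j 1) (z $ j)))"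
      by (simp add: re inner_axis)
    also have "\<dots> = ennreal (\<Prod>j\<in>UNIV. w (axis j 1) (z $ j))"
      by (rule prod_ennreal) (simp add: wnn)
    also have "(\<Prod>j\<in>UNIV. w (axis j 1) (z $ j)) = (\<Prod>j\<in>UNIV. std_normal_density (z $ j) * (if j = i then exp (s * (z $ i)) else 1))"
      by (intro prod.cong) (auto simp: w_def axis_eq_axis)
    also have "\<dots> = (\<Prod>j\<in>UNIV. std_normal_density (z $ j)) * exp (s * (z $ i))"
      by (simp add: prod.distrib)
    finally show "ennreal (\<Prod>j\<in>UNIV. std_normal_density (z $ j)) * ennreal (exp (s * (z $ i))) = (\<Prod>b\<in>Basis. ennreal (w b (z \<bullet> b)))"
      by (simp add: ennreal_mult prod_nonneg)
  qed
  also have "\<dots> = (\<Prod>b\<in>(Basis :: (real ^ 'd) set). \<integral>\<^sup>+x. ennreal (w b x) \<partial>lborel)"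
    by (rule nn_integral_lborel_prod) (auto simp: wnn)
  also have "\<dots> = (\<Prod>j\<in>UNIV. if j = i then ennreal (exp (s\<^sup>2 / 2)) else 1)"
    unfolding re
  proof (rule prod.cong[OF refl])
    fix j :: 'd
    have "(\<integral>\<^sup>+x. ennreal (std_normal_density x) \<partial>lborel) = 1"
      using nn_integral_exp_std_normal[of 0] by simp
    then show "(\<integral>\<^sup>+x. ennreal (w (axis j 1) x) \<partial>lborel) = (if j = i then ennreal (exp (s\<^sup>2 / 2)) else 1)"
      by (auto simp: w_def axis_eq_axis nn_integral_exp_std_normal)
  qed
  also have "\<dots> = ennreal (exp (s\<^sup>2 / 2))" by simp
  finally show ?thesis .
qed

lemma subgaussian_diff_std_gaussian: "subgaussian_diff std_gaussian (\<lambda>z :: real ^ 'd. z $ i) 2"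
proof -
  have [measurable]: "(\<lambda>z :: real ^ 'd. z $ i) \<in> borel_measurable std_gaussian"
    by (rule borel_measurable_same_sets[OF _ borel_measurable_vec_nth]) (simp add: std_gaussian_def)
  show ?thesis unfolding subgaussian_diff_def
    using nn_integral_exp_std_gaussian[of _ i] nn_integral_exp_std_gaussian[of "- _" i]
    by (simp add: nn_integral_exp_diff ennreal_mult[symmetric] exp_add[symmetric])
qed

text \<open>
  For the cube, two values of a coordinate differ by at most \<open>1\<close>; for the Gaussian, the proxy \<open>2\<close> is
  the variance of the difference of two independent standard normal variables.
\<close>

lemma subgaussian_diff_input:
  fixes \<pi> :: "(real ^ 'd) measure"
  assumes "prob_space \<pi>" "sets \<pi> = sets borel" "\<pi> = std_gaussian \<or> (AE z in \<pi>. z \<in> unit_cube)"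
  shows "subgaussian_diff \<pi> (\<lambda>z. z $ i) 2"
  using assms(3)
proof
  assume "\<pi> = std_gaussian"
  then show ?thesis using subgaussian_diff_std_gaussian by simp
next
  interpret prob_space \<pi> by fact
  assume cube: "AE z in \<pi>. z \<in> unit_cube"
  have "subgaussian_diff \<pi> (\<lambda>z. z $ i) (1\<^sup>2)"
  proof (rule subgaussian_diff_bounded)
    show "(\<lambda>z. z $ i) \<in> borel_measurable \<pi>"
      by (rule borel_measurable_same_sets[OF assms(2) borel_measurable_vec_nth])
    have range: "AE z in \<pi>. 0 \<le> z $ i \<and> z $ i \<le> 1"
      using cube by eventually_elim (auto simp: unit_cube_def)
    from range show "AE x in \<pi>. AE y in \<pi>. \<bar>x $ i - y $ i\<bar> \<le> 1"
    proof eventually_elim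
      case (elim x)
      from range show ?case by eventually_elim (use elim in auto)
    qed
  qed
  then show ?thesis by (rule subgaussian_diff_mono) simp
qed

section \<open>Log-density ratios\<close>

lemma lebesgue_density_nonneg: "0 \<le> lebesgue_density \<mu> x"
  by (simp add: lebesgue_density_def)

lemma measurable_lebesgue_density [measurable]: "lebesgue_density \<mu> \<in> borel_measurable borel"
  unfolding lebesgue_density_def[abs_def] using borel_measurable_RN_deriv[of lborel \<mu>] by measurable

lemma density_lebesgue_density:
  fixes \<mu> :: "'a::euclidean_space measure"
  assumes "prob_space \<mu>" "sets \<mu> = sets borel" "absolutely_continuous lborel \<mu>"
  shows "density lborel (\<lambda>x. ennreal (lebesgue_density \<mu> x)) = \<mu>"
proof -
  have s: "sets \<mu> = sets lborel" using assms by simp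
  have "AE x in lborel. RN_deriv lborel \<mu> x \<noteq> \<infinity>"
    using assms s by (intro sigma_finite_measure.RN_deriv_finite lborel.sigma_finite_measure_axioms prob_space_imp_sigma_finite)
  then have "AE x in lborel. ennreal (lebesgue_density \<mu> x) = RN_deriv lborel \<mu> x"
    by eventually_elim (simp add: lebesgue_density_def top.not_eq_extremum)
  then have "density lborel (\<lambda>x. ennreal (lebesgue_density \<mu> x)) = density lborel (RN_deriv lborel \<mu>)"
    by (intro density_cong) auto
  also have "\<dots> = \<mu>" using assms s by (intro sigma_finite_measure.density_RN_deriv lborel.sigma_finite_measure_axioms)
  finally show ?thesis .
qed

text \<open>
  A finite distance excludes that exactly one of the densities vanishes, so that laws at finite
  distance are equivalent with log-density ratio within \<open>a\<close> of the given function.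
\<close>

lemma e2ennreal_log_quotient_le:
  assumes "p \<ge> 0" "q \<ge> 0" "a \<ge> 0" "\<not> (p = 0 \<and> q = 0)"
    and "e2ennreal \<bar>log_quotient p q - ereal u\<bar> \<le> ennreal a"
  shows "p > 0 \<and> q > 0 \<and> \<bar>ln (p / q) - u\<bar> \<le> a"
proof -
  have "q \<noteq> 0"
  proof
    assume "q = 0"
    then show False using assms(5) by (simp add: log_quotient_def top_unique)
  qed
  moreover have "p \<noteq> 0"
  proof
    assume "p = 0"
    then show False using assms(5) \<open>q \<noteq> 0\<close> by (simp add: log_quotient_def top_unique)
  qed
  ultimately show ?thesis using assms by (simp add: log_quotient_def e2ennreal_ereal ennreal_le_iff)
qed

lemma log_ratio_dist_le_imp_AE:
  assumes "log_ratio_dist \<mu> \<nu> f \<le> ennreal a" "a \<ge> 0"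
  shows "AE x in lborel. (lebesgue_density \<mu> x = 0 \<and> lebesgue_density \<nu> x = 0) \<or>
    (lebesgue_density \<mu> x > 0 \<and> lebesgue_density \<nu> x > 0 \<and>
      \<bar>ln (lebesgue_density \<mu> x / lebesgue_density \<nu> x) - f x\<bar> \<le> a)"
proof -
  define F where "F x = (if lebesgue_density \<mu> x = 0 \<and> lebesgue_density \<nu> x = 0 then 0
     else e2ennreal \<bar>log_quotient (lebesgue_density \<mu> x) (lebesgue_density \<nu> x) - ereal (f x)\<bar>)" for x
  have "AE x in lborel. F x \<le> esssup lborel F" by (rule esssup_AE)
  moreover have "esssup lborel F \<le> ennreal a"
    using assms by (simp add: log_ratio_dist_def F_def[abs_def])
  ultimately have "AE x in lborel. F x \<le> ennreal a" by (auto elim!: eventually_mono)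
  then show ?thesis
  proof eventually_elim
    case (elim x)
    show ?case
    proof (cases "lebesgue_density \<mu> x = 0 \<and> lebesgue_density \<nu> x = 0")
      case False
      then have "e2ennreal \<bar>log_quotient (lebesgue_density \<mu> x) (lebesgue_density \<nu> x) - ereal (f x)\<bar> \<le> ennreal a"
        using elim by (simp only: F_def False if_False)
      then show ?thesis
        using e2ennreal_log_quotient_le[OF lebesgue_density_nonneg lebesgue_density_nonneg \<open>a \<ge> 0\<close> False] by blast
    qed simp
  qed
qed

lemma density_ratio:
  fixes \<mu> \<nu> :: "'a::euclidean_space measure" and f :: "'a \<Rightarrow> real"
  assumes \<mu>: "prob_space \<mu>" "sets \<mu> = sets borel" "absolutely_continuous lborel \<mu>"
    and \<nu>: "prob_space \<nu>" "sets \<nu> = sets borel" "absolutely_continuous lborel \<nu>"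
    and AE: "AE x in lborel. (lebesgue_density \<nu> x = 0 \<and> lebesgue_density \<mu> x = 0) \<or>
    (lebesgue_density \<nu> x > 0 \<and> lebesgue_density \<mu> x > 0 \<and>
      \<bar>ln (lebesgue_density \<nu> x / lebesgue_density \<mu> x) - f x\<bar> \<le> a)"
  obtains r where "r \<in> borel_measurable borel" "\<nu> = density \<mu> (\<lambda>x. ennreal (r x))"
    "AE x in \<mu>. 0 < r x \<and> \<bar>ln (r x) - f x\<bar> \<le> a"
proof
  let ?p = "lebesgue_density \<nu>" and ?q = "lebesgue_density \<mu>"
  define r where "r x = ?p x / ?q x" for x
  show r [measurable]: "r \<in> borel_measurable borel" unfolding r_def[abs_def] by measurable
  have "density \<mu> (\<lambda>x. ennreal (r x)) = density (density lborel (\<lambda>x. ennreal (?q x))) (\<lambda>x. ennreal (r x))"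
    by (simp only: density_lebesgue_density[OF \<mu>])
  also have "\<dots> = density lborel (\<lambda>x. ennreal (?q x) * ennreal (r x))"
    by (rule density_density_eq) auto
  also have "\<dots> = density lborel (\<lambda>x. ennreal (?p x))"
  proof (rule density_cong)
    show "AE x in lborel. ennreal (?q x) * ennreal (r x) = ennreal (?p x)"
      using AE by eventually_elim (auto simp: r_def ennreal_mult[symmetric])
  qed auto
  also have "\<dots> = \<nu>" by (rule density_lebesgue_density[OF \<nu>])
  finally show "\<nu> = density \<mu> (\<lambda>x. ennreal (r x))" by simp
  have "AE x in density lborel (\<lambda>x. ennreal (?q x)). 0 < r x \<and> \<bar>ln (r x) - f x\<bar> \<le> a"
    using AE by (subst AE_density) (auto simp: r_def elim!: eventually_mono)
  then show "AE x in \<mu>. 0 < r x \<and> \<bar>ln (r x) - f x\<bar> \<le> a"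
    by (simp only: density_lebesgue_density[OF \<mu>])
qed

lemma wasserstein1_square_le:
  fixes \<pi> \<nu> :: "(real ^ 'd) measure"
  assumes \<pi>: "prob_space \<pi>" "sets \<pi> = sets borel" "\<And>i. subgaussian_diff \<pi> (\<lambda>z. z $ i) 2"
    and \<nu>: "prob_space \<nu>" "sets \<nu> = sets borel" "absolutely_continuous lborel \<nu>"
    and g: "L-lipschitz_on UNIV g" "absolutely_continuous lborel (pushforward \<pi> g)"
    and f: "f \<in> borel_measurable borel" "\<And>x. \<bar>f x\<bar> \<le> B"
    and a: "log_ratio_dist \<nu> (pushforward \<pi> g) f \<le> ennreal a" "a \<ge> 0"
    and c: "c > 0" "2 * (real CARD('d) * L)\<^sup>2 \<le> c"
  shows "(wasserstein1 \<nu> (pushforward \<pi> g))\<^sup>2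
    \<le> ennreal (2 * c * ((\<integral>x. f x \<partial>\<nu>) - (\<integral>x. f x \<partial>pushforward \<pi> g) + 2 * a))"
proof -
  let ?\<mu> = "pushforward \<pi> g"
  define V where "V = 2 * c * ((\<integral>x. f x \<partial>\<nu>) - (\<integral>x. f x \<partial>?\<mu>) + 2 * a)"
  have gm: "g \<in> measurable \<pi> borel"
    by (rule borel_measurable_same_sets[OF \<pi>(2) borel_measurable_continuous_onI[OF lipschitz_on_continuous_on[OF g(1)]]])
  have \<mu>: "prob_space ?\<mu>" "sets ?\<mu> = sets borel"
    using prob_space.prob_space_distr[OF \<pi>(1) gm] by auto
  obtain r where r: "r \<in> borel_measurable borel" "\<nu> = density ?\<mu> (\<lambda>x. ennreal (r x))"
    "AE x in ?\<mu>. 0 < r x \<and> \<bar>ln (r x) - f x\<bar> \<le> a"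
    by (rule density_ratio[OF \<mu> g(2) \<nu> log_ratio_dist_le_imp_AE[OF a]])
  have main: "((\<integral>x. h x \<partial>\<nu>) - (\<integral>x. h x \<partial>?\<mu>))\<^sup>2 \<le> V"
    if h: "1-lipschitz_on UNIV h" "integrable ?\<mu> h" "integrable \<nu> h" for h :: "real ^ 'd \<Rightarrow> real"
    unfolding V_def
  proof (rule transport_log_ratio[OF \<mu>(1) \<nu>(1) r(2) _ _ _ r(3) f(2) h(2,3) _ c(1)])
    have hb: "h \<in> borel_measurable borel"
      by (rule borel_measurable_continuous_onI[OF lipschitz_on_continuous_on[OF h(1)]])
    then show "h \<in> borel_measurable ?\<mu>" "r \<in> borel_measurable ?\<mu>" "f \<in> borel_measurable ?\<mu>"
      using r f by simp_all
    have "(1 * L)-lipschitz_on UNIV (\<lambda>x. h (g x))"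
      by (rule lipschitz_on_compose2[OF g(1) lipschitz_on_subset[OF h(1)]]) auto
    then have "subgaussian_diff \<pi> (\<lambda>x. h (g x)) (2 * (real CARD('d) * L)\<^sup>2)"
      using subgaussian_diff_lipschitz[OF \<pi>] by simp
    then have "subgaussian_diff \<pi> (\<lambda>x. h (g x)) c" using c(2) by (rule subgaussian_diff_mono)
    then show "subgaussian_diff ?\<mu> h c" by (rule subgaussian_diff_distr[OF gm hb])
  qed
  have "0 \<le> V" using main[of "\<lambda>_. 0"] by (simp add: lipschitz_on_def)
  have "wasserstein1 \<nu> ?\<mu> \<le> ennreal (sqrt V)"
    unfolding wasserstein1_def
  proof (intro SUP_least ennreal_leI)
    fix h :: "real ^ 'd \<Rightarrow> real" assume "h \<in> {f. 1-lipschitz_on UNIV f \<and> integrable \<nu> f \<and> integrable ?\<mu> f}"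
    then show "(\<integral>x. h x \<partial>\<nu>) - (\<integral>x. h x \<partial>?\<mu>) \<le> sqrt V" using main by (auto intro: real_le_rsqrt)
  qed
  then have "(wasserstein1 \<nu> ?\<mu>)\<^sup>2 \<le> (ennreal (sqrt V))\<^sup>2" by (intro power_mono) auto
  also have "\<dots> = ennreal V" using \<open>0 \<le> V\<close> by (simp add: ennreal_power)
  finally show ?thesis by (simp add: V_def)
qed

text \<open>
  The transport inequality for the bounded test function \<open>f\<close>, whose differences are at most \<open>2B\<close>, with
  the entropy estimated by comparing the log-density ratio to \<open>0\<close>.
\<close>

lemma bounded_integral_diff_le:
  fixes \<mu> \<nu> :: "'a::euclidean_space measure"
  assumes \<mu>: "prob_space \<mu>" "sets \<mu> = sets borel" "absolutely_continuous lborel \<mu>"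
    and \<nu>: "prob_space \<nu>" "sets \<nu> = sets borel" "absolutely_continuous lborel \<nu>"
    and f: "f \<in> borel_measurable borel" "\<And>x. \<bar>f x\<bar> \<le> B" and "B > 0"
  shows "ennreal ((\<integral>x. f x \<partial>\<nu>) - (\<integral>x. f x \<partial>\<mu>)) \<le> ennreal (4 * B) * ennreal_sqrt (log_ratio_dist \<mu> \<nu> (\<lambda>_. 0))"
proof (cases "log_ratio_dist \<mu> \<nu> (\<lambda>_. 0)")
  case (real K)
  interpret \<mu>: prob_space \<mu> by fact
  interpret \<nu>: prob_space \<nu> by fact
  have fm: "f \<in> borel_measurable \<mu>" "f \<in> borel_measurable \<nu>"
    using borel_measurable_same_sets f(1) \<mu>(2) \<nu>(2) by auto
  have "AE x in lborel. (lebesgue_density \<mu> x = 0 \<and> lebesgue_density \<nu> x = 0) \<or>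
    (lebesgue_density \<mu> x > 0 \<and> lebesgue_density \<nu> x > 0 \<and>
      \<bar>ln (lebesgue_density \<mu> x / lebesgue_density \<nu> x) - 0\<bar> \<le> K)"
    using real by (intro log_ratio_dist_le_imp_AE) auto
  then have "AE x in lborel. (lebesgue_density \<nu> x = 0 \<and> lebesgue_density \<mu> x = 0) \<or>
    (lebesgue_density \<nu> x > 0 \<and> lebesgue_density \<mu> x > 0 \<and>
      \<bar>ln (lebesgue_density \<nu> x / lebesgue_density \<mu> x) - 0\<bar> \<le> K)"
    by eventually_elim (auto simp: ln_div)
  then obtain r where r: "r \<in> borel_measurable borel" "\<nu> = density \<mu> (\<lambda>x. ennreal (r x))"
    "AE x in \<mu>. 0 < r x \<and> \<bar>ln (r x) - 0\<bar> \<le> K"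
    by (rule density_ratio[OF \<mu> \<nu>])
  have "((\<integral>x. f x \<partial>\<nu>) - (\<integral>x. f x \<partial>\<mu>))\<^sup>2 \<le> 2 * (2 * B)\<^sup>2 * ((\<integral>x. 0 \<partial>\<nu>) - (\<integral>x. 0 \<partial>\<mu>) + 2 * K)"
  proof (rule transport_log_ratio[OF \<mu>(1) \<nu>(1) r(2) _ _ fm(1) r(3)])
    show "r \<in> borel_measurable \<mu>" by (rule borel_measurable_same_sets[OF \<mu>(2) r(1)])
    show "integrable \<mu> f" "integrable \<nu> f"
      using f(2) fm by (auto intro!: \<mu>.integrable_const_bound[of _ B] \<nu>.integrable_const_bound[of _ B])
    have "\<bar>f x - f y\<bar> \<le> 2 * B" for x y using f(2)[of x] f(2)[of y] by linarith
    then show "subgaussian_diff \<mu> f ((2 * B)\<^sup>2)" by (intro \<mu>.subgaussian_diff_bounded fm) auto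
  qed (use \<open>B > 0\<close> in auto)
  also have "\<dots> = (4 * B * sqrt K)\<^sup>2" using real by (simp add: power2_eq_square)
  finally have "(\<integral>x. f x \<partial>\<nu>) - (\<integral>x. f x \<partial>\<mu>) \<le> 4 * B * sqrt K"
    by (rule power2_le_imp_le) (use \<open>B > 0\<close> real in simp)
  then show ?thesis using \<open>B > 0\<close> real by (simp add: ennreal_sqrt_ennreal ennreal_mult[symmetric] ennreal_leI)
next
  case top
  then show ?thesis using \<open>B > 0\<close> by (simp add: ennreal_sqrt_def ennreal_mult_top)
qed

section \<open>The risk of the estimator\<close>

text \<open>
  Passes from a bound for every discriminator or generator to the infima in the error terms,
  including the infimum \<open>\<infinity>\<close> over an empty class.
\<close>

lemma le_mult_INF_add:
  fixes x y :: ennreal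
  assumes "c > 0" "\<And>i. i \<in> I \<Longrightarrow> x \<le> ennreal c * f i + y"
  shows "x \<le> ennreal c * (INF i\<in>I. f i) + y"
proof (cases "y = \<infinity>")
  case False
  have c: "ennreal c \<noteq> 0" "ennreal c \<noteq> \<top>" using \<open>c > 0\<close> by auto
  have "(x - y) / ennreal c \<le> (INF i\<in>I. f i)"
  proof (rule INF_greatest)
    fix i assume "i \<in> I"
    then have "x - y \<le> ennreal c * f i"
      using assms(2)[of i] False by (simp add: ennreal_minus_le_iff add.commute)
    then have "(x - y) / ennreal c \<le> (ennreal c * f i) / ennreal c" by (rule divide_right_mono_ennreal)
    also have "\<dots> = f i" using c by (simp add: mult.commute[of "ennreal c"] ennreal_mult_divide_eq)
    finally show "(x - y) / ennreal c \<le> f i" .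
  qed
  then have "ennreal c * ((x - y) / ennreal c) \<le> ennreal c * (INF i\<in>I. f i)" by (intro mult_left_mono) auto
  moreover have "ennreal c * ((x - y) / ennreal c) = x - y"
    using c by (metis ennreal_mult_divide_eq ennreal_times_divide mult.commute)
  ultimately have "x - y \<le> ennreal c * (INF i\<in>I. f i)" by simp
  then show ?thesis using False by (simp add: ennreal_minus_le_iff add.commute)
qed simp

text \<open>
  Along \<open>\<nu>\<close>, empirical \<open>\<nu>\<close>, empirical \<open>\<mu>\<close>, \<open>\<mu>\<close> the gap of the learned generator is its objective plus
  one deviation of each kind. The same chain for the competitor \<open>g\<close>, run backwards, explains the factor
  \<open>2\<close>. The objective has the opposite sign convention to \<open>\<integral>f d\<nu> - \<integral>f d\<mu>\<close>, hence the passage to \<open>-f\<close>.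
\<close>

lemma gan_oracle_inequality:
  fixes \<pi> \<nu> :: "'a measure"
  assumes sym: "\<And>f. f \<in> bounded_class F B \<Longrightarrow> (\<lambda>x. - f x) \<in> bounded_class F B"
    and dev\<nu>: "\<And>f. f \<in> bounded_class F B \<Longrightarrow> (\<integral>x. f x \<partial>\<nu>) - empirical_mean n (snd s) f \<le> e1"
    and dev\<pi>: "\<And>f g. f \<in> bounded_class F B \<Longrightarrow> g \<in> G \<Longrightarrow>
      (\<integral>z. f (g z) \<partial>\<pi>) - empirical_mean m (fst s) (\<lambda>z. f (g z)) \<le> e2"
    and opt: "is_arg_min (gan_objective F B m n s) (\<lambda>g. g \<in> G) ghat"
    and g: "g \<in> G" "\<And>f. f \<in> bounded_class F B \<Longrightarrow> (\<integral>x. f x \<partial>\<nu>) - (\<integral>z. f (g z) \<partial>\<pi>) \<le> D"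
    and f: "f \<in> bounded_class F B"
  shows "(\<integral>x. f x \<partial>\<nu>) - (\<integral>z. f (ghat z) \<partial>\<pi>) \<le> D + 2 * e1 + 2 * e2"
proof -
  have emp_neg: "empirical_mean k w (\<lambda>x. - h x) = - empirical_mean k w h" for k w and h :: "'a \<Rightarrow> real"
    by (simp add: empirical_mean_def sum_negf)
  have ghat: "ghat \<in> G" "gan_objective F B m n s ghat \<le> gan_objective F B m n s g"
    using opt g(1) by (auto simp: is_arg_min_linorder)
  have "gan_objective F B m n s g \<le> ereal (D + e1 + e2)"
    unfolding gan_objective_def
  proof (rule SUP_least)
    fix k assume k: "k \<in> bounded_class F B"
    have "empirical_mean m (fst s) (\<lambda>z. k (g z)) - empirical_mean n (snd s) k \<le> D + e1 + e2"
      using dev\<pi>[OF sym[OF k] g(1)] dev\<nu>[OF k] g(2)[OF sym[OF k]] by (simp add: emp_neg)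
    then show "ereal (empirical_mean m (fst s) (\<lambda>z. k (g z)) - empirical_mean n (snd s) k) \<le> ereal (D + e1 + e2)"
      by simp
  qed
  with ghat(2) have "gan_objective F B m n s ghat \<le> ereal (D + e1 + e2)" by (rule order_trans)
  moreover have "ereal (empirical_mean m (fst s) (\<lambda>z. - f (ghat z)) - empirical_mean n (snd s) (\<lambda>x. - f x))
      \<le> gan_objective F B m n s ghat"
    unfolding gan_objective_def by (rule SUP_upper2[OF sym[OF f]]) simp
  ultimately have "empirical_mean m (fst s) (\<lambda>z. - f (ghat z)) - empirical_mean n (snd s) (\<lambda>x. - f x) \<le> D + e1 + e2"
    by (meson ereal_less_eq(3) order_trans)
  then show ?thesis
    using dev\<pi>[OF sym[OF f] ghat(1)] dev\<nu>[OF f] by (simp add: emp_neg)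
qed

lemma bounded_class_uminus:
  assumes "symmetric_class F" "f \<in> bounded_class F B"
  shows "(\<lambda>x. - f x) \<in> bounded_class F B"
  using assms unfolding symmetric_class_def bounded_class_def by auto

lemma comp_class_mono: "F \<subseteq> F' \<Longrightarrow> comp_class F G \<subseteq> comp_class F' G"
  unfolding comp_class_def by blast

lemma deviation_bound:
  assumes "deviation H n M w \<le> ennreal e" "e \<ge> 0" "h \<in> H"
  shows "(\<integral>x. h x \<partial>M) - empirical_mean n w h \<le> e"
proof -
  have "ennreal ((\<integral>x. h x \<partial>M) - empirical_mean n w h) \<le> deviation H n M w"
    unfolding deviation_def using assms(3) by (rule SUP_upper)
  then show ?thesis using assms(1,2) by (meson ennreal_le_iff order_trans)
qed

text \<open>
  The pointwise bound for one sample, with a discriminator \<open>f\<close> and a competitor \<open>g\<close> still free. If any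
  term on the right is infinite there is nothing to prove.
\<close>

lemma wasserstein1_gan_le:
  fixes \<pi> \<nu> :: "(real ^ 'd) measure" and F :: "(real ^ 'd \<Rightarrow> real) set" and G :: "(real ^ 'd \<Rightarrow> real ^ 'd) set"
  assumes "B > 0" and sym: "symmetric_class F"
    and F: "\<And>f. f \<in> F \<Longrightarrow> L_F-lipschitz_on UNIV f" and G: "\<And>g. g \<in> G \<Longrightarrow> L_G-lipschitz_on UNIV g"
    and \<pi>: "prob_space \<pi>" "sets \<pi> = sets borel" "\<And>i. subgaussian_diff \<pi> (\<lambda>z. z $ i) 2"
    and \<nu>: "prob_space \<nu>" "sets \<nu> = sets borel" "absolutely_continuous lborel \<nu>"
    and ac: "\<And>g. g \<in> G \<Longrightarrow> absolutely_continuous lborel (pushforward \<pi> g)"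
    and opt: "is_arg_min (gan_objective F B m n s) (\<lambda>g. g \<in> G) ghat"
    and c: "c > 0" "2 * (real CARD('d) * L_G)\<^sup>2 \<le> c"
    and f: "f \<in> bounded_class F B" and g: "g \<in> G"
  shows "(wasserstein1 \<nu> (pushforward \<pi> ghat))\<^sup>2 \<le> ennreal (4 * c) * log_ratio_dist \<nu> (pushforward \<pi> ghat) f +
    (ennreal (8 * c * B) * ennreal_sqrt (log_ratio_dist (pushforward \<pi> g) \<nu> (\<lambda>_. 0)) +
     (ennreal (4 * c) * deviation (bounded_class F B) n \<nu> (snd s) +
      ennreal (4 * c) * deviation (comp_class (bounded_class F B) G) m \<pi> (fst s)))"
    (is "?W \<le> ennreal (4 * c) * ?l + (ennreal (8 * c * B) * ?q + (ennreal (4 * c) * ?d1 + ennreal (4 * c) * ?d2))")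
proof (cases "?l = \<top> \<or> ?q = \<top> \<or> ?d1 = \<top> \<or> ?d2 = \<top>")
  case True
  then show ?thesis using \<open>B > 0\<close> c by (auto simp: ennreal_mult_top)
next
  case False
  then obtain l q d1 d2 where real: "?l = ennreal l" "?q = ennreal q" "?d1 = ennreal d1" "?d2 = ennreal d2"
    "l \<ge> 0" "q \<ge> 0" "d1 \<ge> 0" "d2 \<ge> 0"
    by (metis ennreal_cases)
  have ghat: "ghat \<in> G" using opt by (simp add: is_arg_min_def)
  have mG: "k \<in> measurable \<pi> borel" if "k \<in> G" for k
    by (rule borel_measurable_same_sets[OF \<pi>(2) borel_measurable_continuous_onI[OF lipschitz_on_continuous_on[OF G[OF that]]]])
  have mF: "k \<in> borel_measurable borel" if "k \<in> bounded_class F B" for k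
    by (rule borel_measurable_continuous_onI[OF lipschitz_on_continuous_on[OF F]]) (use that in \<open>simp add: bounded_class_def\<close>)
  have bd: "\<bar>k x\<bar> \<le> B" if "k \<in> bounded_class F B" for k x using that by (simp add: bounded_class_def)
  have push: "(\<integral>x. k x \<partial>pushforward \<pi> j) = (\<integral>z. k (j z) \<partial>\<pi>)" if "k \<in> bounded_class F B" "j \<in> G" for k j
    by (rule integral_distr[OF mG[OF that(2)] mF[OF that(1)]])
  have "(\<integral>x. f x \<partial>\<nu>) - (\<integral>z. f (ghat z) \<partial>\<pi>) \<le> 4 * B * q + 2 * d1 + 2 * d2"
  proof (rule gan_oracle_inequality[OF _ _ _ opt g _ f])
    show "(\<lambda>x. - k x) \<in> bounded_class F B" if "k \<in> bounded_class F B" for k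
      using sym that by (rule bounded_class_uminus)
    show "(\<integral>x. k x \<partial>\<nu>) - empirical_mean n (snd s) k \<le> d1" if "k \<in> bounded_class F B" for k
      by (rule deviation_bound[OF _ _ that]) (use real in auto)
    show "(\<integral>z. k (j z) \<partial>\<pi>) - empirical_mean m (fst s) (\<lambda>z. k (j z)) \<le> d2"
      if "k \<in> bounded_class F B" "j \<in> G" for k j
    proof (rule deviation_bound)
      show "(\<lambda>z. k (j z)) \<in> comp_class (bounded_class F B) G"
        unfolding comp_class_def using that by (auto simp: comp_def)
    qed (use real in auto)
    show "(\<integral>x. k x \<partial>\<nu>) - (\<integral>z. k (g z) \<partial>\<pi>) \<le> 4 * B * q" if k: "k \<in> bounded_class F B" for k
    proof -
      have "prob_space (pushforward \<pi> g)" using mG[OF g] by (rule prob_space.prob_space_distr[OF \<pi>(1)])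
      then have "ennreal ((\<integral>x. k x \<partial>\<nu>) - (\<integral>x. k x \<partial>pushforward \<pi> g)) \<le> ennreal (4 * B) * ?q"
        using \<nu> ac[OF g] mF[OF k] bd[OF k] \<open>B > 0\<close> by (intro bounded_integral_diff_le) auto
      also have "\<dots> = ennreal (4 * B * q)" unfolding real(2) using \<open>B > 0\<close> real by (intro ennreal_mult[symmetric]) auto
      finally show ?thesis unfolding push[OF k g] using \<open>B > 0\<close> real(6) by (subst (asm) ennreal_le_iff) auto
    qed
  qed
  then have gap: "(\<integral>x. f x \<partial>\<nu>) - (\<integral>x. f x \<partial>pushforward \<pi> ghat) + 2 * l \<le> 2 * l + (4 * B * q + 2 * d1 + 2 * d2)"
    unfolding push[OF f ghat] by simp
  have "?W \<le> ennreal (2 * c * ((\<integral>x. f x \<partial>\<nu>) - (\<integral>x. f x \<partial>pushforward \<pi> ghat) + 2 * l))"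
  proof (rule wasserstein1_square_le[OF \<pi> \<nu> G[OF ghat] ac[OF ghat] mF[OF f] bd[OF f] _ _ c])
    show "?l \<le> ennreal l" "0 \<le> l" using real by simp_all
  qed
  also have "\<dots> \<le> ennreal (2 * c * (2 * l + (4 * B * q + 2 * d1 + 2 * d2)))"
    using gap c by (intro ennreal_leI mult_left_mono) auto
  also have "2 * c * (2 * l + (4 * B * q + 2 * d1 + 2 * d2)) = 4 * c * l + (8 * c * B * q + (4 * c * d1 + 4 * c * d2))"
    by (simp add: algebra_simps)
  also have "ennreal \<dots> = ennreal (4 * c * l) + (ennreal (8 * c * B * q) + (ennreal (4 * c * d1) + ennreal (4 * c * d2)))"
    using real c \<open>B > 0\<close> by (subst ennreal_plus, simp, simp)+ simp
  also have "\<dots> = ennreal (4 * c) * ?l + (ennreal (8 * c * B) * ?q + (ennreal (4 * c) * ?d1 + ennreal (4 * c) * ?d2))"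
    unfolding real(1-4) using real(5-8) c \<open>B > 0\<close> by (intro arg_cong2[where f="(+)"] ennreal_mult) auto
  finally show ?thesis .
qed

lemma wasserstein1_gan_le_A1_A2:
  fixes \<pi> \<nu> :: "(real ^ 'd) measure" and F :: "(real ^ 'd \<Rightarrow> real) set" and G :: "(real ^ 'd \<Rightarrow> real ^ 'd) set"
  assumes "B > 0" and sym: "symmetric_class F"
    and F: "\<And>f. f \<in> F \<Longrightarrow> L_F-lipschitz_on UNIV f" and G: "\<And>g. g \<in> G \<Longrightarrow> L_G-lipschitz_on UNIV g"
    and \<pi>: "prob_space \<pi>" "sets \<pi> = sets borel" "\<And>i. subgaussian_diff \<pi> (\<lambda>z. z $ i) 2"
    and \<nu>: "prob_space \<nu>" "sets \<nu> = sets borel" "absolutely_continuous lborel \<nu>"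
    and ac: "\<And>g. g \<in> G \<Longrightarrow> absolutely_continuous lborel (pushforward \<pi> g)"
    and opt: "is_arg_min (gan_objective F B m n s) (\<lambda>g. g \<in> G) ghat"
    and c: "c > 0" "2 * (real CARD('d) * L_G)\<^sup>2 \<le> c"
  shows "(wasserstein1 \<nu> (pushforward \<pi> ghat))\<^sup>2
    \<le> (ennreal (8 * c) * A1 F G B \<pi> \<nu> + ennreal (32 * sqrt 2 * c) * A2 G B \<pi> \<nu>) +
     (ennreal (4 * c) * deviation (bounded_class F B) n \<nu> (snd s) +
      ennreal (4 * c) * deviation (comp_class (bounded_class F B) G) m \<pi> (fst s))"
    (is "?W \<le> _ + ?d")
proof -
  have ghat: "ghat \<in> G" using opt by (simp add: is_arg_min_def)
  let ?l = "\<lambda>f. log_ratio_dist \<nu> (pushforward \<pi> ghat) f"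
  let ?q = "\<lambda>g. ennreal_sqrt (log_ratio_dist (pushforward \<pi> g) \<nu> (\<lambda>_. 0))"
  have step1: "?W \<le> ennreal (4 * c) * (INF f\<in>bounded_class F B. ?l f) + (ennreal (8 * c * B) * ?q g + ?d)" if "g \<in> G" for g
    using c wasserstein1_gan_le[OF assms _ that] by (intro le_mult_INF_add) auto
  have "?W \<le> ennreal (8 * c * B) * (INF g\<in>G. ?q g) + (ennreal (4 * c) * (INF f\<in>bounded_class F B. ?l f) + ?d)"
    using c \<open>B > 0\<close> step1 by (intro le_mult_INF_add) (simp_all add: add.left_commute)
  also have "ennreal (4 * c) * (INF f\<in>bounded_class F B. ?l f) \<le> ennreal (8 * c) * A1 F G B \<pi> \<nu>"
  proof -
    have "(INF f\<in>bounded_class F B. ?l f) \<le> (SUP g\<in>G. INF f\<in>bounded_class F B. log_ratio_dist \<nu> (pushforward \<pi> g) f)"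
      using ghat by (rule SUP_upper)
    then have "ennreal (4 * c) * (INF f\<in>bounded_class F B. ?l f)
        \<le> ennreal (4 * c) * (SUP g\<in>G. INF f\<in>bounded_class F B. log_ratio_dist \<nu> (pushforward \<pi> g) f)"
      by (rule mult_left_mono) simp
    moreover have "ennreal (4 * c) = ennreal (8 * c) * ennreal (1 / 2)" using c by (subst ennreal_mult[symmetric]) auto
    ultimately show ?thesis by (simp only: A1_def mult.assoc)
  qed
  also have "ennreal (8 * c * B) * (INF g\<in>G. ?q g) = ennreal (32 * sqrt 2 * c) * A2 G B \<pi> \<nu>"
  proof -
    have "8 * c * B = (32 * sqrt 2 * c) * (B / (4 * sqrt 2))" by simp
    then have "ennreal (8 * c * B) = ennreal (32 * sqrt 2 * c) * ennreal (B / (4 * sqrt 2))"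
      using c \<open>B > 0\<close> by (simp only:) (intro ennreal_mult, auto)
    then show ?thesis by (simp only: A2_def mult.assoc)
  qed
  finally show ?thesis by (simp add: add_ac)
qed

lemma expected_deviations_le_Snm:
  fixes \<pi> \<nu> :: "(real ^ 'd) measure" and F :: "(real ^ 'd \<Rightarrow> real) set" and G :: "(real ^ 'd \<Rightarrow> real ^ 'd) set"
  assumes "B > 0" and sym: "symmetric_class F"
    and F: "\<And>f. f \<in> F \<Longrightarrow> L_F-lipschitz_on UNIV f" and G: "\<And>g. g \<in> G \<Longrightarrow> L_G-lipschitz_on UNIV g"
    and \<pi>: "prob_space \<pi>" "sets \<pi> = sets borel" and \<nu>: "prob_space \<nu>" "sets \<nu> = sets borel"
    and "m \<ge> 2" "n \<ge> 2"
  shows "(\<integral>\<^sup>+ w. deviation (bounded_class F B) n \<nu> w \<partial>PiM {..<n} (\<lambda>_. \<nu>)) \<le> ennreal (11 * B) * Snm n m F G"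
    and "(\<integral>\<^sup>+ w. deviation (comp_class (bounded_class F B) G) m \<pi> w \<partial>PiM {..<m} (\<lambda>_. \<pi>)) \<le> ennreal (11 * B) * Snm n m F G"
    and "deviation (bounded_class F B) n \<nu> \<in> borel_measurable (PiM {..<n} (\<lambda>_. \<nu>))"
    and "deviation (comp_class (bounded_class F B) G) m \<pi> \<in> borel_measurable (PiM {..<m} (\<lambda>_. \<pi>))"
proof -
  have contF: "continuous_on UNIV f" if "f \<in> bounded_class F B" for f
    using that F by (auto simp: bounded_class_def intro: lipschitz_on_continuous_on)
  have bdF: "\<bar>f x\<bar> \<le> B" if "f \<in> bounded_class F B" for f x using that by (simp add: bounded_class_def)
  have contFG: "continuous_on UNIV h" if "h \<in> comp_class (bounded_class F B) G" for h
  proof -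
    obtain f g where fg: "h = f \<circ> g" "f \<in> bounded_class F B" "g \<in> G"
      using \<open>h \<in> comp_class (bounded_class F B) G\<close> unfolding comp_class_def by blast
    have "continuous_on (range g) f" using contF[OF fg(2)] by (rule continuous_on_subset) simp
    with lipschitz_on_continuous_on[OF G[OF fg(3)]] show ?thesis unfolding fg(1) by (rule continuous_on_compose)
  qed
  have bdFG: "\<bar>h x\<bar> \<le> B" if "h \<in> comp_class (bounded_class F B) G" for h x
    using that bdF unfolding comp_class_def by auto
  have symF: "(\<lambda>x. - f x) \<in> bounded_class F B" if "f \<in> bounded_class F B" for f
    using sym that by (rule bounded_class_uminus)
  have symFG: "(\<lambda>x. - h x) \<in> comp_class (bounded_class F B) G" if "h \<in> comp_class (bounded_class F B) G" for h
  proof -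
    obtain f g where fg: "h = f \<circ> g" "f \<in> bounded_class F B" "g \<in> G"
      using \<open>h \<in> comp_class (bounded_class F B) G\<close> unfolding comp_class_def by blast
    have "(\<lambda>x. - h x) = (\<lambda>x. - f x) \<circ> g" by (simp add: fg(1) comp_def)
    then show ?thesis unfolding comp_class_def using symF[OF fg(2)] fg(3) by blast
  qed
  have sub: "bounded_class F B \<subseteq> F" by (auto simp: bounded_class_def)
  have of_enat_mono: "ennreal_of_enat a \<le> ennreal_of_enat b" if "a \<le> b" for a b
    using that by (simp add: ennreal_of_enat_le_iff)
  have "(\<integral>\<^sup>+ w. deviation (bounded_class F B) n \<nu> w \<partial>PiM {..<n} (\<lambda>_. \<nu>))
      \<le> ennreal (11 * B) * ennreal_sqrt (ennreal_of_enat (Pdim (bounded_class F B)) * ennreal (ln (real n) / real n))"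
    by (rule expected_deviation_le_Pdim[OF \<nu>]) (fact contF bdF symF \<open>B > 0\<close> \<open>n \<ge> 2\<close>)+
  also have "\<dots> \<le> ennreal (11 * B) * Snm n m F G"
    unfolding Snm_def
    by (intro mult_left_mono max.coboundedI1 ennreal_sqrt_mono mult_mono of_enat_mono Pdim_mono sub ennreal_leI[OF max.cobounded2]) auto
  finally show "(\<integral>\<^sup>+ w. deviation (bounded_class F B) n \<nu> w \<partial>PiM {..<n} (\<lambda>_. \<nu>)) \<le> ennreal (11 * B) * Snm n m F G" .
  have "(\<integral>\<^sup>+ w. deviation (comp_class (bounded_class F B) G) m \<pi> w \<partial>PiM {..<m} (\<lambda>_. \<pi>))
      \<le> ennreal (11 * B) * ennreal_sqrt (ennreal_of_enat (Pdim (comp_class (bounded_class F B) G)) * ennreal (ln (real m) / real m))"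
    by (rule expected_deviation_le_Pdim[OF \<pi>]) (fact contFG bdFG symFG \<open>B > 0\<close> \<open>m \<ge> 2\<close>)+
  also have "\<dots> \<le> ennreal (11 * B) * Snm n m F G"
    unfolding Snm_def
    by (intro mult_left_mono max.coboundedI2 ennreal_sqrt_mono mult_mono of_enat_mono Pdim_mono comp_class_mono sub) auto
  finally show "(\<integral>\<^sup>+ w. deviation (comp_class (bounded_class F B) G) m \<pi> w \<partial>PiM {..<m} (\<lambda>_. \<pi>)) \<le> ennreal (11 * B) * Snm n m F G" .
  show "deviation (bounded_class F B) n \<nu> \<in> borel_measurable (PiM {..<n} (\<lambda>_. \<nu>))"
    by (rule measurable_deviation[OF \<nu>]) (fact contF bdF)+
  show "deviation (comp_class (bounded_class F B) G) m \<pi> \<in> borel_measurable (PiM {..<m} (\<lambda>_. \<pi>))"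
    by (rule measurable_deviation[OF \<pi>]) (fact contFG bdFG)+
qed

lemma nn_integral_sample_law:
  assumes "prob_space \<pi>" "prob_space \<nu>"
  shows "f \<in> borel_measurable (PiM {..<m} (\<lambda>_. \<pi>)) \<Longrightarrow>
      (\<integral>\<^sup>+ s. f (fst s) \<partial>sample_law m n \<pi> \<nu>) = (\<integral>\<^sup>+ w. f w \<partial>PiM {..<m} (\<lambda>_. \<pi>))"
    and "h \<in> borel_measurable (PiM {..<n} (\<lambda>_. \<nu>)) \<Longrightarrow>
      (\<integral>\<^sup>+ s. h (snd s) \<partial>sample_law m n \<pi> \<nu>) = (\<integral>\<^sup>+ w. h w \<partial>PiM {..<n} (\<lambda>_. \<nu>))"
proof -
  interpret P: prob_space "PiM {..<m} (\<lambda>_. \<pi>)" using assms by (intro prob_space_PiM)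
  interpret N: prob_space "PiM {..<n} (\<lambda>_. \<nu>)" using assms by (intro prob_space_PiM)
  show "(\<integral>\<^sup>+ s. f (fst s) \<partial>sample_law m n \<pi> \<nu>) = (\<integral>\<^sup>+ w. f w \<partial>PiM {..<m} (\<lambda>_. \<pi>))"
    if [measurable]: "f \<in> borel_measurable (PiM {..<m} (\<lambda>_. \<pi>))"
    unfolding sample_law_def by (subst N.nn_integral_fst[symmetric]) (simp_all add: N.emeasure_space_1)
  show "(\<integral>\<^sup>+ s. h (snd s) \<partial>sample_law m n \<pi> \<nu>) = (\<integral>\<^sup>+ w. h w \<partial>PiM {..<n} (\<lambda>_. \<nu>))"
    if [measurable]: "h \<in> borel_measurable (PiM {..<n} (\<lambda>_. \<nu>))"
    unfolding sample_law_def by (subst N.nn_integral_fst[symmetric]) (simp_all add: P.emeasure_space_1)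
qed

theorem corollary16:
  fixes B L_F L_G :: real
  assumes "B > 0"
  shows "\<exists>C1 C2 C3 :: real. C1 > 0 \<and> C2 > 0 \<and> C3 > 0 \<and>
    (\<forall>(F :: (real ^ 'd \<Rightarrow> real) set) (G :: (real ^ 'd \<Rightarrow> real ^ 'd) set)
       (\<pi> :: (real ^ 'd) measure) (\<nu> :: (real ^ 'd) measure) (m :: nat) (n :: nat)
       (ghat :: (nat \<Rightarrow> real ^ 'd) \<times> (nat \<Rightarrow> real ^ 'd) \<Rightarrow> (real ^ 'd \<Rightarrow> real ^ 'd)).
       symmetric_class F \<longrightarrow> symmetric_class (comp_class F G) \<longrightarrow>
       (\<forall>f\<in>F. L_F-lipschitz_on UNIV f) \<longrightarrow> (\<forall>g\<in>G. L_G-lipschitz_on UNIV g) \<longrightarrow>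
       prob_space \<pi> \<longrightarrow> sets \<pi> = sets borel \<longrightarrow>
       prob_space \<nu> \<longrightarrow> sets \<nu> = sets borel \<longrightarrow>
       absolutely_continuous lborel \<nu> \<longrightarrow>
       (\<forall>g\<in>G. absolutely_continuous lborel (pushforward \<pi> g)) \<longrightarrow>
       m \<ge> 2 \<longrightarrow> n \<ge> 2 \<longrightarrow>
       (AE s in sample_law m n \<pi> \<nu>.
          is_arg_min (gan_objective F B m n s) (\<lambda>g. g \<in> G) (ghat s)) \<longrightarrow>
       (\<pi> = std_gaussian \<or> (AE z in \<pi>. z \<in> unit_cube) \<and> (AE x in \<nu>. x \<in> unit_cube)) \<longrightarrow>
       (\<integral>\<^sup>+ s. (wasserstein1 \<nu> (pushforward \<pi> (ghat s)))\<^sup>2 \<partial>sample_law m n \<pi> \<nu>)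
         \<le> ennreal C1 * A1 F G B \<pi> \<nu> + ennreal C2 * A2 G B \<pi> \<nu> + ennreal C3 * Snm n m F G)"
proof -
  \<comment> \<open>The summand \<open>1\<close> keeps the constants positive when \<open>L_G = 0\<close>.\<close>
  define c where "c = 2 * (real CARD('d) * L_G)\<^sup>2 + 1"
  have c: "c > 0" "2 * (real CARD('d) * L_G)\<^sup>2 \<le> c"
    unfolding c_def by (simp_all add: add_nonneg_pos)
  show ?thesis
  proof (rule exI[of _ "8 * c"], rule exI[of _ "32 * sqrt 2 * c"], rule exI[of _ "88 * B * c"], intro conjI allI impI)
    show "8 * c > 0" "32 * sqrt 2 * c > 0" "88 * B * c > 0" using c \<open>B > 0\<close> by simp_all
    fix F :: "(real ^ 'd \<Rightarrow> real) set" and G :: "(real ^ 'd \<Rightarrow> real ^ 'd) set"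
      and \<pi> \<nu> :: "(real ^ 'd) measure" and m n :: nat
      and ghat :: "(nat \<Rightarrow> real ^ 'd) \<times> (nat \<Rightarrow> real ^ 'd) \<Rightarrow> (real ^ 'd \<Rightarrow> real ^ 'd)"
    assume sym: "symmetric_class F"
      and F: "\<forall>f\<in>F. L_F-lipschitz_on UNIV f" and G: "\<forall>g\<in>G. L_G-lipschitz_on UNIV g"
      and \<pi>: "prob_space \<pi>" "sets \<pi> = sets borel"
      and \<nu>: "prob_space \<nu>" "sets \<nu> = sets borel" "absolutely_continuous lborel \<nu>"
      and ac: "\<forall>g\<in>G. absolutely_continuous lborel (pushforward \<pi> g)"
      and mn: "m \<ge> 2" "n \<ge> 2"
      and opt: "AE s in sample_law m n \<pi> \<nu>. is_arg_min (gan_objective F B m n s) (\<lambda>g. g \<in> G) (ghat s)"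
      and input: "\<pi> = std_gaussian \<or> (AE z in \<pi>. z \<in> unit_cube) \<and> (AE x in \<nu>. x \<in> unit_cube)"
    let ?P = "sample_law m n \<pi> \<nu>" and ?A = "ennreal (8 * c) * A1 F G B \<pi> \<nu> + ennreal (32 * sqrt 2 * c) * A2 G B \<pi> \<nu>"
    define d1 where "d1 = deviation (bounded_class F B) n \<nu>"
    define d2 where "d2 = deviation (comp_class (bounded_class F B) G) m \<pi>"
    have sub: "subgaussian_diff \<pi> (\<lambda>z. z $ i) 2" for i
      using input by (intro subgaussian_diff_input \<pi>) auto
    have dev: "(\<integral>\<^sup>+ w. d1 w \<partial>PiM {..<n} (\<lambda>_. \<nu>)) \<le> ennreal (11 * B) * Snm n m F G"
      "(\<integral>\<^sup>+ w. d2 w \<partial>PiM {..<m} (\<lambda>_. \<pi>)) \<le> ennreal (11 * B) * Snm n m F G"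
      and d1 [measurable]: "d1 \<in> borel_measurable (PiM {..<n} (\<lambda>_. \<nu>))"
      and d2 [measurable]: "d2 \<in> borel_measurable (PiM {..<m} (\<lambda>_. \<pi>))"
      unfolding d1_def d2_def
      using expected_deviations_le_Snm[OF \<open>B > 0\<close> sym F[rule_format] G[rule_format] \<pi> \<nu>(1,2) mn] by blast+
    interpret P: prob_space "PiM {..<m} (\<lambda>_. \<pi>)" using \<pi> by (intro prob_space_PiM)
    interpret N: prob_space "PiM {..<n} (\<lambda>_. \<nu>)" using \<nu> by (intro prob_space_PiM)
    interpret S: pair_prob_space "PiM {..<m} (\<lambda>_. \<pi>)" "PiM {..<n} (\<lambda>_. \<nu>)" ..
    have meas: "(\<lambda>s. d1 (snd s)) \<in> borel_measurable ?P" "(\<lambda>s. d2 (fst s)) \<in> borel_measurable ?P"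
      unfolding sample_law_def by measurable
    have one: "emeasure ?P (space ?P) = 1"
      unfolding sample_law_def by (rule S.emeasure_space_1)
    have "(\<integral>\<^sup>+ s. (wasserstein1 \<nu> (pushforward \<pi> (ghat s)))\<^sup>2 \<partial>?P)
        \<le> (\<integral>\<^sup>+ s. ?A + (ennreal (4 * c) * d1 (snd s) + ennreal (4 * c) * d2 (fst s)) \<partial>?P)"
    proof (rule nn_integral_mono_AE)
      show "AE s in ?P. (wasserstein1 \<nu> (pushforward \<pi> (ghat s)))\<^sup>2
          \<le> ?A + (ennreal (4 * c) * d1 (snd s) + ennreal (4 * c) * d2 (fst s))"
        using opt
      proof eventually_elim
        case (elim s)
        show ?case unfolding d1_def d2_def
          by (rule wasserstein1_gan_le_A1_A2[OF \<open>B > 0\<close> sym F[rule_format] G[rule_format] \<pi> sub \<nu> ac[rule_format] elim c])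
      qed
    qed
    also have "\<dots> = ?A + (ennreal (4 * c) * (\<integral>\<^sup>+ s. d1 (snd s) \<partial>?P) + ennreal (4 * c) * (\<integral>\<^sup>+ s. d2 (fst s) \<partial>?P))"
      using meas one by (simp add: nn_integral_add nn_integral_cmult)
    also have "\<dots> = ?A + (ennreal (4 * c) * (\<integral>\<^sup>+ w. d1 w \<partial>PiM {..<n} (\<lambda>_. \<nu>)) + ennreal (4 * c) * (\<integral>\<^sup>+ w. d2 w \<partial>PiM {..<m} (\<lambda>_. \<pi>)))"
      by (simp only: nn_integral_sample_law[OF \<pi>(1) \<nu>(1)] d1 d2)
    also have "\<dots> \<le> ?A + (ennreal (4 * c) * (ennreal (11 * B) * Snm n m F G) + ennreal (4 * c) * (ennreal (11 * B) * Snm n m F G))"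
      by (intro add_left_mono add_mono mult_left_mono dev) auto
    also have "ennreal (4 * c) * (ennreal (11 * B) * Snm n m F G) + ennreal (4 * c) * (ennreal (11 * B) * Snm n m F G)
        = ennreal (88 * B * c) * Snm n m F G"
    proof -
      have "ennreal (88 * B * c) = ennreal (4 * c * (11 * B) + 4 * c * (11 * B))" by (simp add: algebra_simps)
      also have "\<dots> = ennreal (4 * c * (11 * B)) + ennreal (4 * c * (11 * B))"
        using c \<open>B > 0\<close> by (intro ennreal_plus) auto
      also have "ennreal (4 * c * (11 * B)) = ennreal (4 * c) * ennreal (11 * B)"
        using c \<open>B > 0\<close> by (intro ennreal_mult) auto
      finally show ?thesis by (simp only: distrib_right mult.assoc)
    qed
    finally show "(\<integral>\<^sup>+ s. (wasserstein1 \<nu> (pushforward \<pi> (ghat s)))\<^sup>2 \<partial>?P) \<le> ?A + ennreal (88 * B * c) * Snm n m F G" .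
  qed
qed

end
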